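(* The species $\mathbb{WNP}$ of finite nonempty WN posets and the species $\mathbb{CP}_\triangledown$ of finite nonempty $\triangledown$-compatible posets are isomorphic (as species). An isomorphism is given by the bijections $\theta$ from the set of WN posets on $A$ to the set of $\triangledown$-compatible posets on $A$ ($A$ any finite nonempty set) defined inductively by: - if $\mathcal A$ is a one-element poset, $\theta(\mathcal A)=\mathcal A$; - if $\mathcal A=\mathcal A_1\cdots\mathcal A_k$ is not connected, with connected components $\mathcal A_1,\dots,\mathcal A_k$, then $\theta(\mathcal A)=\theta(\mathcal A_1)\cdots\theta(\mathcal A_k)$; - if $\mathcal A$ is connected with more than one element, written (uniquely) $\mathcal A=\mathcal A_1\downarrow\mathcal A_2$ with $\mathcal A_1,\mathcal A_2$ nonempty WN posets and $\mathcal A_2$ not connected or reduced to one element, then $\theta(\mathcal A)=\theta(\mathcal A_1)\triangledown\theta(\mathcal A_2)$.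
   Context: Connectedness of a poset is connectedness of its Hasse diagram. For posets $\mathcal A,\mathcal B$ on disjoint sets $A,B$: $\mathcal A\mathcal B$ is the disjoint union (no relations between $A$ and $B$); $\mathcal A\downarrow\mathcal B$ is $A\sqcup B$ with the orders of $\mathcal A$, $\mathcal B$ and $x\le y$ for all $x\in A$, $y\in B$; $\mathcal A\triangledown\mathcal B$ is $A\sqcup B$ with the orders of $\mathcal A$, $\mathcal B$ together with $x\le y$ for all $x\in\min(\mathcal B)$, $y\in A$ (and no other relations). A finite poset is WN if it contains no subposet (induced order) isomorphic to the four-element poset $\{x,y,z,t\}$ whose only strict relations are $x<z$, $y<z$, $y<t$. For a finite poset $\mathcal A=(A,\le_A)$ let $A'=\{y\in A\mid\forall x\in\min(\mathcal A),\ x<_Ay\}$, $b\mathcal A=\mathcal A_{|A'}$, $r\mathcal A=\mathcal A_{|A\setminus A'}$. $\triangledown$-compatible posets are defined inductively on cardinality $n\ge1$: a one-element poset is $\triangledown$-compatible; if $n\ge2$, $\mathcal A$ is $\triangledown$-compatible iff either (1) $\mathcal A$ is not connected and all its connected components are $\triangledown$-compatible, or (2) $\mathcal A$ is connected, $b\mathcal A$ is nonempty, $b\mathcal A$ and $r\mathcal A$ are $\triangledown$-compatible, and $\mathcal A=b\mathcal A\triangledown r\mathcal A$. The species assign to a finite nonempty set $A$ the vector space freely generated by the WN (resp. $\triangledown$-compatible) posets on $A$, with bijections acting by relabelling; an isomorphism of species is a family of isomorphisms natural in relabelling. *)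

theory Defs
  imports Complex_Main "HOL-Library.Poly_Mapping"
begin

section \<open>Finite posets\<close>

text \<open>
  A poset on \<open>A\<close> is a reflexive order relation \<open>r\<close> with \<open>partial_order_on A r\<close>. By reflexivity
  \<open>A = Field r\<close>, so the relation alone determines the poset, the relation \<open>{}\<close> is the empty poset,
  and \<open>Restr r B\<close> is the induced order on \<open>B \<subseteq> Field r\<close>.
\<close>

definition finite_poset :: "'a rel \<Rightarrow> bool" where
  "finite_poset r \<longleftrightarrow> finite (Field r) \<and> Partial_order r"

definition covering :: "'a rel \<Rightarrow> 'a rel" where
  "covering r = {(x, y) \<in> r. x \<noteq> y \<and> \<not> (\<exists>z. z \<noteq> x \<and> z \<noteq> y \<and> (x, z) \<in> r \<and> (z, y) \<in> r)}"

definition hasse_linked :: "'a rel \<Rightarrow> 'a rel" where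
  "hasse_linked r = (covering r \<union> (covering r)\<inverse>)\<^sup>*"

definition connected_poset :: "'a rel \<Rightarrow> bool" where
  "connected_poset r \<longleftrightarrow> (\<forall>x\<in>Field r. \<forall>y\<in>Field r. (x, y) \<in> hasse_linked r)"

definition components :: "'a rel \<Rightarrow> 'a rel set" where
  "components r = (\<lambda>C. Restr r C) ` (Field r // hasse_linked r)"

definition min_elts :: "'a rel \<Rightarrow> 'a set" where
  "min_elts r = {x \<in> Field r. \<forall>y. (y, x) \<in> r \<longrightarrow> y = x}"

text \<open>
  The two products below are used only for posets with disjoint fields. The product
  \<open>\<A>\<B>\<close> of such posets is the union of the relations.
\<close>

definition down_prod :: "'a rel \<Rightarrow> 'a rel \<Rightarrow> 'a rel" (infixl "\<down>" 70) where
  "r \<down> s = r \<union> s \<union> Field r \<times> Field s"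

definition tri_prod :: "'a rel \<Rightarrow> 'a rel \<Rightarrow> 'a rel" (infixl "\<triangledown>" 70) where
  "r \<triangledown> s = r \<union> s \<union> min_elts s \<times> Field r"

definition poset_isomorphic :: "'a rel \<Rightarrow> 'b rel \<Rightarrow> bool" where
  "poset_isomorphic r s \<longleftrightarrow>
     (\<exists>f. bij_betw f (Field r) (Field s) \<and>
       (\<forall>x\<in>Field r. \<forall>y\<in>Field r. (x, y) \<in> r \<longleftrightarrow> (f x, f y) \<in> s))"

text \<open>The poset \<open>x < z > y < t\<close>, with \<open>x, y, z, t\<close> encoded as \<open>0, 1, 2, 3\<close>.\<close>

definition N_poset :: "nat rel" where
  "N_poset = Id_on {0, 1, 2, 3} \<union> {(0, 2), (1, 2), (1, 3)}"

definition WN :: "'a rel \<Rightarrow> bool" where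
  "WN r \<longleftrightarrow> finite_poset r \<and> \<not> (\<exists>B \<subseteq> Field r. poset_isomorphic (Restr r B) N_poset)"

definition above_min :: "'a rel \<Rightarrow> 'a set" where
  "above_min r = {y \<in> Field r. \<forall>x\<in>min_elts r. (x, y) \<in> r \<and> x \<noteq> y}"

definition b_part :: "'a rel \<Rightarrow> 'a rel" where
  "b_part r = Restr r (above_min r)"

definition r_part :: "'a rel \<Rightarrow> 'a rel" where
  "r_part r = Restr r (Field r - above_min r)"

text \<open>
  The recursion on the cardinality is rendered as a least fixed point: the components of a
  disconnected poset, and \<open>b_part r\<close> and \<open>r_part r\<close> when \<open>b_part r \<noteq> {}\<close>, are strictly smaller
  than \<open>r\<close>.
\<close>

inductive tri_compatible :: "'a rel \<Rightarrow> bool" where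
  single: "tri_compatible {(x, x)}"
| disconnected:
    "tri_compatible r"
    if "finite_poset r" "card (Field r) \<ge> 2" "\<not> connected_poset r"
      "\<forall>c\<in>components r. tri_compatible c"
| connected:
    "tri_compatible r"
    if "finite_poset r" "card (Field r) \<ge> 2" "connected_poset r" "b_part r \<noteq> {}"
      "tri_compatible (b_part r)" "tri_compatible (r_part r)"
      "r = b_part r \<triangledown> r_part r"

definition WN_posets_on :: "'a set \<Rightarrow> 'a rel set" where
  "WN_posets_on A = {r. partial_order_on A r \<and> WN r}"

definition tri_compatible_posets_on :: "'a set \<Rightarrow> 'a rel set" where
  "tri_compatible_posets_on A = {r. partial_order_on A r \<and> tri_compatible r}"

definition relabel :: "('a \<Rightarrow> 'b) \<Rightarrow> 'a rel \<Rightarrow> 'b rel" where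
  "relabel \<sigma> r = map_prod \<sigma> \<sigma> ` r"


section \<open>The map \<open>\<theta>\<close>\<close>

definition down_decomposition :: "'a rel \<Rightarrow> 'a rel \<Rightarrow> 'a rel \<Rightarrow> bool" where
  "down_decomposition r r1 r2 \<longleftrightarrow>
     WN r1 \<and> r1 \<noteq> {} \<and> WN r2 \<and> r2 \<noteq> {} \<and> Field r1 \<inter> Field r2 = {} \<and>
     (\<not> connected_poset r2 \<or> card (Field r2) = 1) \<and> r = r1 \<down> r2"

text \<open>
  \<open>\<theta>\<close> obeys the inductive definition on all finite nonempty WN posets over the type \<open>'a\<close>; its
  values elsewhere are irrelevant.
\<close>

definition theta_recursion :: "('a rel \<Rightarrow> 'a rel) \<Rightarrow> bool" where
  "theta_recursion \<theta> \<longleftrightarrow>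
     (\<forall>x. \<theta> {(x, x)} = {(x, x)}) \<and>
     (\<forall>r. WN r \<and> \<not> connected_poset r \<longrightarrow> \<theta> r = (\<Union>c\<in>components r. \<theta> c)) \<and>
     (\<forall>r r1 r2. WN r \<and> connected_poset r \<and> card (Field r) > 1 \<and> down_decomposition r r1 r2
        \<longrightarrow> \<theta> r = \<theta> r1 \<triangledown> \<theta> r2)"


section \<open>Linear species on nonempty finite sets\<close>

text \<open>
  A species assigns to each finite nonempty set \<open>A\<close> of labels a subspace \<open>obj F A\<close> of an ambient
  vector space, and to each bijection \<open>\<sigma>\<close> from \<open>A\<close> to \<open>B\<close> a linear map \<open>act F A \<sigma>\<close> from
  \<open>obj F A\<close> to \<open>obj F B\<close>. A bijection between sets is given by a total function of which only the
  values on \<open>A\<close> matter.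
\<close>

record ('a, 'v) species =
  obj :: "'a set \<Rightarrow> 'v set"
  act :: "'a set \<Rightarrow> ('a \<Rightarrow> 'a) \<Rightarrow> 'v \<Rightarrow> 'v"

definition linear_from_to ::
  "('k::field \<Rightarrow> 'v::ab_group_add \<Rightarrow> 'v) \<Rightarrow> ('k \<Rightarrow> 'w::ab_group_add \<Rightarrow> 'w)
     \<Rightarrow> 'v set \<Rightarrow> 'w set \<Rightarrow> ('v \<Rightarrow> 'w) \<Rightarrow> bool" where
  "linear_from_to scV scW V W f \<longleftrightarrow>
     f ` V \<subseteq> W \<and>
     (\<forall>x\<in>V. \<forall>y\<in>V. f (x + y) = f x + f y) \<and>
     (\<forall>c. \<forall>x\<in>V. f (scV c x) = scW c (f x))"

definition linear_species ::
  "('k::field \<Rightarrow> 'v::ab_group_add \<Rightarrow> 'v) \<Rightarrow> ('a, 'v) species \<Rightarrow> bool" where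
  "linear_species sc F \<longleftrightarrow>
     vector_space sc \<and>
     (\<forall>A. finite A \<and> A \<noteq> {} \<longrightarrow> module.subspace sc (obj F A)) \<and>
     (\<forall>A B \<sigma>. finite A \<and> A \<noteq> {} \<and> bij_betw \<sigma> A B \<longrightarrow>
        linear_from_to sc sc (obj F A) (obj F B) (act F A \<sigma>)) \<and>
     (\<forall>A \<sigma> \<sigma>'. finite A \<and> A \<noteq> {} \<and> inj_on \<sigma> A \<and> (\<forall>x\<in>A. \<sigma> x = \<sigma>' x) \<longrightarrow>
        (\<forall>v\<in>obj F A. act F A \<sigma> v = act F A \<sigma>' v)) \<and>
     (\<forall>A. finite A \<and> A \<noteq> {} \<longrightarrow> (\<forall>v\<in>obj F A. act F A id v = v)) \<and>
     (\<forall>A B C \<sigma> \<tau>. finite A \<and> A \<noteq> {} \<and> bij_betw \<sigma> A B \<and> bij_betw \<tau> B C \<longrightarrow>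
        (\<forall>v\<in>obj F A. act F A (\<tau> \<circ> \<sigma>) v = act F B \<tau> (act F A \<sigma> v)))"

definition species_iso ::
  "('k::field \<Rightarrow> 'v::ab_group_add \<Rightarrow> 'v) \<Rightarrow> ('k \<Rightarrow> 'w::ab_group_add \<Rightarrow> 'w)
     \<Rightarrow> ('a, 'v) species \<Rightarrow> ('a, 'w) species \<Rightarrow> ('a set \<Rightarrow> 'v \<Rightarrow> 'w) \<Rightarrow> bool" where
  "species_iso scV scW F G \<phi> \<longleftrightarrow>
     linear_species scV F \<and> linear_species scW G \<and>
     (\<forall>A. finite A \<and> A \<noteq> {} \<longrightarrow>
        linear_from_to scV scW (obj F A) (obj G A) (\<phi> A) \<and> bij_betw (\<phi> A) (obj F A) (obj G A)) \<and>
     (\<forall>A B \<sigma>. finite A \<and> A \<noteq> {} \<and> bij_betw \<sigma> A B \<longrightarrow>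
        (\<forall>v\<in>obj F A. \<phi> B (act F A \<sigma> v) = act G A \<sigma> (\<phi> A v)))"

definition species_isomorphic ::
  "('k::field \<Rightarrow> 'v::ab_group_add \<Rightarrow> 'v) \<Rightarrow> ('k \<Rightarrow> 'w::ab_group_add \<Rightarrow> 'w)
     \<Rightarrow> ('a, 'v) species \<Rightarrow> ('a, 'w) species \<Rightarrow> bool" where
  "species_isomorphic scV scW F G \<longleftrightarrow> (\<exists>\<phi>. species_iso scV scW F G \<phi>)"

text \<open>
  The vector space freely generated by a set \<open>S\<close> of elements of type \<open>'p\<close> is the set of formal
  linear combinations of type \<open>'p \<Rightarrow>\<^sub>0 'k\<close> with support in \<open>S\<close>.
\<close>

definition fscale :: "'k::field \<Rightarrow> ('p \<Rightarrow>\<^sub>0 'k) \<Rightarrow> ('p \<Rightarrow>\<^sub>0 'k)" where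
  "fscale c v = Poly_Mapping.map ((*) c) v"

definition free_on :: "'p set \<Rightarrow> ('p \<Rightarrow>\<^sub>0 'k::field) set" where
  "free_on S = {v. Poly_Mapping.keys v \<subseteq> S}"

definition lin_ext :: "('p \<Rightarrow> 'q) \<Rightarrow> ('p \<Rightarrow>\<^sub>0 'k::field) \<Rightarrow> ('q \<Rightarrow>\<^sub>0 'k)" where
  "lin_ext f v = (\<Sum>p\<in>Poly_Mapping.keys v. Poly_Mapping.single (f p) (Poly_Mapping.lookup v p))"

definition poset_species :: "('a set \<Rightarrow> 'a rel set) \<Rightarrow> ('a, 'a rel \<Rightarrow>\<^sub>0 'k::field) species" where
  "poset_species P = \<lparr>obj = (\<lambda>A. free_on (P A)), act = (\<lambda>A \<sigma>. lin_ext (relabel \<sigma>))\<rparr>"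

definition WNP_species :: "('a, 'a rel \<Rightarrow>\<^sub>0 'k::field) species" where
  "WNP_species = poset_species WN_posets_on"

definition CP_tri_species :: "('a, 'a rel \<Rightarrow>\<^sub>0 'k::field) species" where
  "CP_tri_species = poset_species tri_compatible_posets_on"

end

theory Submission
  imports Defs
begin

text \<open>
  Both kinds of posets have the same recursive structure. A poset is disconnected and determined
  by its components, or a singleton, or a connected composite of two smaller posets of which the
  second is disconnected or a singleton, the two factors being unique. For WN posets the composite
  is \<open>\<down>\<close>, for \<open>\<triangledown>\<close>-compatible posets it is \<open>\<triangledown>\<close>; so the recursion exchanging the two products
  has an inverse of the same form.

  The factors of a connected WN poset \<open>r\<close> are found as follows. A point above the largest possible
  number of minimal elements is above all of them: otherwise some N appears, by connectedness.
  N-freeness then puts \<open>above_min r\<close> above everything else. So \<open>r\<close> has a proper nonempty up-set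
  lying above its complement; such up-sets are linearly ordered by inclusion, and the smallest one
  carries the second factor.
\<close>

section \<open>Finite posets and their connected components\<close>

text \<open>The condition on the second factor, disconnected or a singleton, does not occur in the
  definition of \<triangledown>-compatibility. There it has to be recovered: a connected
  \<open>r_part r\<close> with two points or more would have a nonempty \<open>b_part\<close>, whose
  points lie above all minimal elements of \<open>r\<close> and so belong to
  \<open>b_part r\<close>. Conversely, the condition ensures that \<open>above_min\<close> of
  \<open>r1 \<triangledown> r2\<close> is exactly the field of \<open>r1\<close>, so the factors can
  be read off and no search among up-sets is needed on this side. Since the condition mentions
  connectedness and the products need disjoint fields, the recursion turns one decomposition into
  another only if it preserves fields and connectedness; both travel in the induction together with
  membership in the target class. Connectedness is handled through sets closed under comparability
  rather than through paths in the Hasse diagram. Closure of \<triangledown>-compatible posets under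
  relabelling is inherited from WN posets by naturality of the map.\<close>

lemma finite_posetI:
  assumes "finite (Field r)" "\<And>x. x \<in> Field r \<Longrightarrow> (x, x) \<in> r"
    "\<And>x y z. (x, y) \<in> r \<Longrightarrow> (y, z) \<in> r \<Longrightarrow> (x, z) \<in> r"
    "\<And>x y. (x, y) \<in> r \<Longrightarrow> (y, x) \<in> r \<Longrightarrow> x = y"
  shows "finite_poset r"
  using assms
  unfolding finite_poset_def partial_order_on_def preorder_on_def refl_on_def trans_def antisym_def
  by (auto simp: Field_def)

lemma finite_posetD:
  assumes "finite_poset r"
  shows "finite (Field r)" "x \<in> Field r \<Longrightarrow> (x, x) \<in> r"
    "(x, y) \<in> r \<Longrightarrow> (y, z) \<in> r \<Longrightarrow> (x, z) \<in> r"
    "(x, y) \<in> r \<Longrightarrow> (y, x) \<in> r \<Longrightarrow> x = y"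
  using assms
  unfolding finite_poset_def partial_order_on_def preorder_on_def refl_on_def trans_def antisym_def
  by blast+

lemma partial_order_on_iff_finite_poset:
  "finite A \<Longrightarrow> partial_order_on A r \<longleftrightarrow> finite_poset r \<and> Field r = A"
proof
  assume "finite A" and r: "partial_order_on A r"
  then have "Field r = A"
    unfolding partial_order_on_def preorder_on_def refl_on_def by (auto simp: Field_def)
  then show "finite_poset r \<and> Field r = A"
    using r \<open>finite A\<close> by (auto simp: finite_poset_def)
qed (auto simp: finite_poset_def)

lemma finite_poset_singleton: "finite_poset {(x, x)}"
  by (rule finite_posetI) auto

lemma finite_poset_card_1:
  assumes "finite_poset r" "card (Field r) = 1"
  obtains x where "r = {(x, x)}"
proof -
  obtain x where x: "Field r = {x}"
    using assms(2) by (auto simp: card_1_singleton_iff)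
  have "(x, x) \<in> r"
    using finite_posetD(2)[OF assms(1)] x by auto
  moreover have "r \<subseteq> Field r \<times> Field r"
    by (auto simp: Field_def)
  ultimately have "r = {(x, x)}"
    using x by auto
  then show ?thesis ..
qed

lemma Field_Restr:
  assumes "finite_poset r" "U \<subseteq> Field r"
  shows "Field (Restr r U) = U"
proof
  show "U \<subseteq> Field (Restr r U)"
    using finite_posetD(2)[OF assms(1)] assms(2) by (blast intro: FieldI1)
qed (auto simp: Field_def)

lemma finite_poset_Restr:
  assumes "finite_poset r"
  shows "finite_poset (Restr r U)"
proof (rule finite_posetI)
  show "finite (Field (Restr r U))"
    by (rule finite_subset[OF _ finite_posetD(1)[OF assms]]) (auto simp: Field_def)
qed (use finite_posetD(2-)[OF assms] in \<open>auto simp: Field_def\<close>)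

section \<open>Minimal elements, the Hasse diagram and connectedness\<close>

lemma ex_min_below:
  assumes "finite_poset r" "x \<in> Field r"
  obtains m where "m \<in> min_elts r" "(m, x) \<in> r"
proof -
  let ?D = "{y. (y, x) \<in> r}"
  have "finite ?D"
    by (rule finite_subset[OF _ finite_posetD(1)[OF assms(1)]]) (auto simp: Field_def)
  moreover have "x \<in> ?D"
    using finite_posetD(2)[OF assms(1)] assms(2) by auto
  \<comment> \<open>Descent: if some \<open>y\<close> lies strictly below \<open>x\<close>, its
    down-set omits \<open>x\<close> and is smaller.\<close>
  ultimately have "\<exists>m\<in>?D. \<forall>y\<in>?D. (y, m) \<in> r \<longrightarrow> y = m"
  proof (induction "card ?D" arbitrary: x rule: less_induct)
    case less
    show ?case
    proof (cases "\<forall>y. (y, x) \<in> r \<longrightarrow> y = x")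
      case True
      then show ?thesis using less.prems by blast
    next
      case False
      then obtain y where y: "(y, x) \<in> r" "y \<noteq> x" by blast
      let ?E = "{z. (z, y) \<in> r}"
      have sub: "?E \<subseteq> {y. (y, x) \<in> r}"
        using y finite_posetD(3)[OF assms(1)] by blast
      moreover have "x \<notin> ?E"
        using y finite_posetD(4)[OF assms(1)] by blast
      ultimately have "?E \<subset> {y. (y, x) \<in> r}"
        using less.prems by blast
      then have "card ?E < card {y. (y, x) \<in> r}"
        using less.prems(1) by (rule psubset_card_mono[rotated])
      moreover have "y \<in> ?E"
        using finite_posetD(2)[OF assms(1)] y by (auto simp: Field_def)
      moreover have "finite ?E"
        using sub less.prems(1) by (rule finite_subset)
      ultimately obtain m where m: "m \<in> ?E" "\<forall>w\<in>?E. (w, m) \<in> r \<longrightarrow> w = m"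
        using less.hyps by blast
      then show ?thesis
        using sub finite_posetD(3)[OF assms(1)] by blast
    qed
  qed
  then obtain m where "(m, x) \<in> r" "\<forall>y. (y, x) \<in> r \<longrightarrow> (y, m) \<in> r \<longrightarrow> y = m"
    by blast
  then show ?thesis
    using finite_posetD(3)[OF assms(1)]
    by (intro that[of m]) (auto simp: min_elts_def Field_def)
qed

text \<open>A comparability in a finite poset refines to a chain of coverings. This allows arguing
  with comparabilities, which are easier to restrict and to transport than coverings.\<close>

lemma hasse_linked_eq:
  assumes "finite_poset r"
  shows "hasse_linked r = (r \<union> r\<inverse>)\<^sup>*"
proof
  have "covering r \<union> (covering r)\<inverse> \<subseteq> r \<union> r\<inverse>"
    by (auto simp: covering_def)
  then show "hasse_linked r \<subseteq> (r \<union> r\<inverse>)\<^sup>*"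
    unfolding hasse_linked_def by (rule rtrancl_mono)
  have *: "(x, y) \<in> (covering r)\<^sup>*" if "(x, y) \<in> r" for x y
    using that
  proof (induction "card {z. (x, z) \<in> r \<and> (z, y) \<in> r}" arbitrary: x y rule: less_induct)
    case less
    note trans = finite_posetD(3)[OF assms] and antisym = finite_posetD(4)[OF assms]
    have fin: "finite {z. (x, z) \<in> r \<and> (z, y) \<in> r}"
      by (rule finite_subset[OF _ finite_posetD(1)[OF assms]]) (auto simp: Field_def)
    have refl: "(x, x) \<in> r" "(y, y) \<in> r"
      using finite_posetD(2)[OF assms] less.prems by (auto simp: Field_def)
    show ?case
    proof (cases "x = y \<or> (x, y) \<in> covering r")
      case True
      then show ?thesis by auto
    next
      case False
      then obtain z where z: "z \<noteq> x" "z \<noteq> y" "(x, z) \<in> r" "(z, y) \<in> r"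
        using less.prems by (auto simp: covering_def)
      \<comment> \<open>Each half of the interval omits one of its endpoints: the lower half
        \<open>y\<close>, the upper half \<open>x\<close>.\<close>
      have "{w. (x, w) \<in> r \<and> (w, z) \<in> r} \<subset> {w. (x, w) \<in> r \<and> (w, y) \<in> r}"
        using z trans antisym refl less.prems by blast
      moreover have "{w. (z, w) \<in> r \<and> (w, y) \<in> r} \<subset> {w. (x, w) \<in> r \<and> (w, y) \<in> r}"
        using z trans antisym refl less.prems by blast
      ultimately have "(x, z) \<in> (covering r)\<^sup>*" "(z, y) \<in> (covering r)\<^sup>*"
        using less.hyps z psubset_card_mono[OF fin] by blast+
      then show ?thesis by simp
    qed
  qed
  have mono: "(covering r)\<^sup>* \<subseteq> hasse_linked r" "((covering r)\<inverse>)\<^sup>* \<subseteq> hasse_linked r"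
    unfolding hasse_linked_def by (auto intro!: rtrancl_mono)
  have "r \<subseteq> hasse_linked r"
    using * mono(1) by auto
  moreover have "r\<inverse> \<subseteq> hasse_linked r"
    using * mono(2) by (auto simp: rtrancl_converse)
  ultimately have "(r \<union> r\<inverse>)\<^sup>* \<subseteq> (hasse_linked r)\<^sup>*"
    by (intro rtrancl_mono) auto
  then show "(r \<union> r\<inverse>)\<^sup>* \<subseteq> hasse_linked r"
    by (simp add: hasse_linked_def)
qed

text \<open>In a finite poset these are the unions of connected components. They turn connectedness
  into propagation of membership along \<open>r\<close>, which avoids handling paths.\<close>

definition saturated :: "'a rel \<Rightarrow> 'a set \<Rightarrow> bool" where
  "saturated r U \<longleftrightarrow> U \<subseteq> Field r \<and> (\<forall>x y. (x, y) \<in> r \<longrightarrow> (x \<in> U \<longleftrightarrow> y \<in> U))"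

lemma saturated_linked:
  assumes "finite_poset r" "saturated r U" "(x, y) \<in> hasse_linked r" "x \<in> U"
  shows "y \<in> U"
  using assms(3,4) unfolding hasse_linked_eq[OF assms(1)]
  by (induction rule: rtrancl_induct) (use assms(2) in \<open>auto simp: saturated_def\<close>)

lemma hasse_linked_sym: "(x, y) \<in> hasse_linked r \<Longrightarrow> (y, x) \<in> hasse_linked r"
proof -
  have "sym (hasse_linked r)"
    unfolding hasse_linked_def by (rule sym_rtrancl) (auto simp: sym_def)
  then show "(x, y) \<in> hasse_linked r \<Longrightarrow> (y, x) \<in> hasse_linked r"
    by (rule symD)
qed

lemma hasse_linked_trans:
  "(x, y) \<in> hasse_linked r \<Longrightarrow> (y, z) \<in> hasse_linked r \<Longrightarrow> (x, z) \<in> hasse_linked r"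
  unfolding hasse_linked_def by simp

lemma saturated_class:
  assumes "finite_poset r" "x \<in> Field r"
  shows "saturated r (hasse_linked r `` {x})"
proof -
  have sub: "r \<subseteq> hasse_linked r"
    unfolding hasse_linked_eq[OF assms(1)] by auto
  have "y \<in> Field r" if "(x, y) \<in> hasse_linked r" for y
    using that assms(2) unfolding hasse_linked_eq[OF assms(1)]
    by (induction rule: rtrancl_induct) (auto simp: Field_def)
  moreover have "(x, z) \<in> hasse_linked r \<longleftrightarrow> (x, y) \<in> hasse_linked r" if "(z, y) \<in> r" for y z
    using that sub hasse_linked_sym[of z y r] hasse_linked_trans[of x z r y]
      hasse_linked_trans[of x y r z] by auto
  ultimately show ?thesis
    unfolding saturated_def by auto
qed

text \<open>The class of a point is itself saturated and nonempty, so it is everything as soon as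
  only the trivial sets are saturated.\<close>

lemma connected_iff_saturated:
  assumes "finite_poset r"
  shows "connected_poset r \<longleftrightarrow> (\<forall>U. saturated r U \<longrightarrow> U = {} \<or> U = Field r)"
proof (intro iffI allI impI)
  fix U assume "connected_poset r" "saturated r U"
  then show "U = {} \<or> U = Field r"
    unfolding connected_poset_def using saturated_linked[OF assms \<open>saturated r U\<close>]
    by (auto simp: saturated_def)
next
  assume *: "\<forall>U. saturated r U \<longrightarrow> U = {} \<or> U = Field r"
  show "connected_poset r"
    unfolding connected_poset_def
  proof (intro ballI)
    fix x y assume xy: "x \<in> Field r" "y \<in> Field r"
    have "x \<in> hasse_linked r `` {x}"
      by (simp add: hasse_linked_def)
    then have "hasse_linked r `` {x} = Field r"
      using * saturated_class[OF assms xy(1)] by auto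
    then show "(x, y) \<in> hasse_linked r"
      using xy(2) by auto
  qed
qed

section \<open>Connected components\<close>

lemma Field_UN: "Field (\<Union>S) = (\<Union>c\<in>S. Field c)"
  by (auto simp: Field_def)

lemma connected_saturated:
  "finite_poset r \<Longrightarrow> connected_poset r \<Longrightarrow> saturated r U \<Longrightarrow> U \<noteq> {} \<Longrightarrow> U = Field r"
  using connected_iff_saturated by blast

text \<open>These are the families that arise as sets of components:
  \<open>disjoint_connected_components\<close> and \<open>components_Union\<close> are the two
  directions. The components of a constructed poset are then found by exhibiting such a
  family.\<close>

definition disjoint_connected :: "'a rel set \<Rightarrow> bool" where
  "disjoint_connected S \<longleftrightarrow>
     (\<forall>c\<in>S. finite_poset c \<and> c \<noteq> {} \<and> connected_poset c) \<and>
     (\<forall>c\<in>S. \<forall>d\<in>S. Field c \<inter> Field d \<noteq> {} \<longrightarrow> c = d)"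

lemma Field_nonempty: "r \<noteq> {} \<Longrightarrow> Field r \<noteq> {}"
  by (auto simp: Field_def)

lemma saturated_Restr:
  assumes "finite_poset r" "saturated r C" "saturated (Restr r C) U"
  shows "saturated r U"
  using assms(2,3) Field_Restr[OF assms(1), of C] unfolding saturated_def
  by auto

lemma component_cases:
  assumes "finite_poset r" "c \<in> components r"
  obtains x where "x \<in> Field r" "c = Restr r (hasse_linked r `` {x})"
    "Field c = hasse_linked r `` {x}"
  using assms(2) Field_Restr[OF assms(1)] saturated_class[OF assms(1)]
  unfolding components_def quotient_def saturated_def by blast

lemma Union_components:
  assumes "finite_poset r"
  shows "\<Union>(components r) = r"
proof
  show "r \<subseteq> \<Union>(components r)"
  proof
    fix p assume "p \<in> r"
    then obtain x y where p: "p = (x, y)" "(x, y) \<in> r"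
      by (cases p) auto
    then have "(x, y) \<in> hasse_linked r" "(x, x) \<in> hasse_linked r"
      by (auto simp: hasse_linked_eq[OF assms])
    moreover have "x \<in> Field r"
      using p by (auto simp: Field_def)
    ultimately show "p \<in> \<Union>(components r)"
      using p unfolding components_def quotient_def by auto
  qed
qed (auto simp: components_def)

lemma disjoint_connected_components:
  assumes "finite_poset r"
  shows "disjoint_connected (components r)"
  unfolding disjoint_connected_def
proof (intro conjI ballI impI)
  fix c assume c: "c \<in> components r"
  obtain x
    where x: "x \<in> Field r" "c = Restr r (hasse_linked r `` {x})" "Field c = hasse_linked r `` {x}"
    by (rule component_cases[OF assms c])
  have xx: "x \<in> hasse_linked r `` {x}"
    by (simp add: hasse_linked_def)
  show poset: "finite_poset c"
    using finite_poset_Restr[OF assms] x by auto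
  show "c \<noteq> {}"
    using x(3) xx by auto
  show "connected_poset c"
    unfolding connected_iff_saturated[OF poset]
  proof (intro allI impI)
    fix U assume U: "saturated c U"
    then have sat: "saturated r U"
      using saturated_Restr[OF assms saturated_class[OF assms x(1)]] x(2) by auto
    have "U \<subseteq> hasse_linked r `` {x}"
      using U x(3) by (auto simp: saturated_def)
    \<comment> \<open>A point of \<open>U\<close> is linked to \<open>x\<close>, and
      \<open>U\<close> is saturated in all of \<open>r\<close>, so \<open>U\<close> contains
      everything linked to \<open>x\<close>.\<close>
    moreover have "hasse_linked r `` {x} \<subseteq> U" if "y \<in> U" for y
    proof
      fix z assume "z \<in> hasse_linked r `` {x}"
      moreover have "(y, x) \<in> hasse_linked r"
        by (rule hasse_linked_sym) (use that \<open>U \<subseteq> _\<close> in auto)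
      ultimately have "(y, z) \<in> hasse_linked r"
        using hasse_linked_trans by auto
      then show "z \<in> U"
        using saturated_linked[OF assms sat] that by auto
    qed
    ultimately show "U = {} \<or> U = Field c"
      using x(3) by auto
  qed
next
  fix c d assume c: "c \<in> components r" and d: "d \<in> components r" and "Field c \<inter> Field d \<noteq> {}"
  then obtain z where z: "z \<in> Field c" "z \<in> Field d" by auto
  obtain x
    where x: "c = Restr r (hasse_linked r `` {x})" "Field c = hasse_linked r `` {x}"
    by (rule component_cases[OF assms c])
  obtain y
    where y: "d = Restr r (hasse_linked r `` {y})" "Field d = hasse_linked r `` {y}"
    by (rule component_cases[OF assms d])
  have "hasse_linked r `` {x} = hasse_linked r `` {y}"
  proof (rule set_eqI)
    fix w
    have "(x, z) \<in> hasse_linked r" "(y, z) \<in> hasse_linked r"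
      using z x y by auto
    then show "w \<in> hasse_linked r `` {x} \<longleftrightarrow> w \<in> hasse_linked r `` {y}"
      by (meson Image_singleton_iff hasse_linked_sym hasse_linked_trans)
  qed
  then show "c = d"
    using x y by auto
qed

text \<open>Disjointness makes every \<open>Field c\<close> saturated in the union, so a class that
  meets \<open>c\<close> stays inside it. The class is also saturated in \<open>c\<close>, and
  connectedness of \<open>c\<close> makes it fill \<open>Field c\<close>.\<close>

lemma components_Union:
  assumes S: "disjoint_connected S" and poset: "finite_poset (\<Union>S)"
  shows "components (\<Union>S) = S"
proof -
  have sat: "saturated (\<Union>S) (Field c)" if "c \<in> S" for c
  proof -
    have "x \<in> Field c \<longleftrightarrow> y \<in> Field c" if "(x, y) \<in> d" "d \<in> S" for x y d
    proof -
      have "x \<in> Field d" "y \<in> Field d"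
        using that(1) by (auto simp: Field_def)
      then show ?thesis
        using S \<open>c \<in> S\<close> that(2) by (auto simp: disjoint_connected_def)
    qed
    then show ?thesis
      using \<open>c \<in> S\<close> unfolding saturated_def Field_UN by blast
  qed
  have cls: "Restr (\<Union>S) (hasse_linked (\<Union>S) `` {x}) = c" if c: "c \<in> S" "x \<in> Field c" for c x
  proof -
    let ?C = "hasse_linked (\<Union>S) `` {x}"
    have xS: "x \<in> Field (\<Union>S)"
      using c by (auto simp: Field_def)
    have sub: "?C \<subseteq> Field c"
      using saturated_linked[OF poset sat[OF c(1)]] c(2) by auto
    moreover have "saturated c ?C"
      unfolding saturated_def
    proof (intro conjI allI impI sub)
      fix y z assume "(y, z) \<in> c"
      then have "(y, z) \<in> \<Union>S"
        using c(1) by blast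
      then show "y \<in> ?C \<longleftrightarrow> z \<in> ?C"
        using saturated_class[OF poset xS] unfolding saturated_def by blast
    qed
    moreover have "x \<in> ?C"
      by (simp add: hasse_linked_def)
    moreover have "finite_poset c" "connected_poset c"
      using S c unfolding disjoint_connected_def by auto
    ultimately have "?C = Field c"
      using connected_iff_saturated by blast
    moreover have "Restr (\<Union>S) (Field c) = c"
    proof
      show "Restr (\<Union>S) (Field c) \<subseteq> c"
      proof
        fix p assume "p \<in> Restr (\<Union>S) (Field c)"
        then obtain x y d where "p = (x, y)" "x \<in> Field c" "(x, y) \<in> d" "d \<in> S"
          by auto
        moreover from this have "x \<in> Field d"
          by (auto simp: Field_def)
        ultimately show "p \<in> c"
          using S c(1) by (auto simp: disjoint_connected_def)
      qed
    qed (use c in \<open>auto simp: Field_def\<close>)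
    ultimately show ?thesis by simp
  qed
  show ?thesis
  proof
    show "components (\<Union>S) \<subseteq> S"
    proof
      fix c assume "c \<in> components (\<Union>S)"
      then obtain x
        where x: "x \<in> Field (\<Union>S)" and c: "c = Restr (\<Union>S) (hasse_linked (\<Union>S) `` {x})"
        by (rule component_cases[OF poset])
      from x obtain d where d: "d \<in> S" "x \<in> Field d"
        unfolding Field_UN by blast
      show "c \<in> S"
        unfolding c cls[OF d] by (rule d(1))
    qed
    show "S \<subseteq> components (\<Union>S)"
    proof
      fix c assume c: "c \<in> S"
      then have "c \<noteq> {}"
        using S by (simp add: disjoint_connected_def)
      then obtain x where x: "x \<in> Field c"
        using Field_nonempty[of c] by auto
      then have "x \<in> Field (\<Union>S)"
        using c by (auto simp: Field_def)
      then show "c \<in> components (\<Union>S)"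
        using cls[OF c x] unfolding components_def quotient_def by blast
    qed
  qed
qed

text \<open>If \<open>r\<close> is connected, \<open>{r}\<close> is a
  \<open>disjoint_connected\<close> family with union \<open>r\<close>, hence the family of
  components.\<close>

lemma connected_iff_components:
  assumes "finite_poset r" "r \<noteq> {}"
  shows "connected_poset r \<longleftrightarrow> components r = {r}"
proof
  assume "connected_poset r"
  then have "disjoint_connected {r}"
    using assms by (auto simp: disjoint_connected_def)
  then show "components r = {r}"
    using components_Union[of "{r}"] assms by auto
next
  assume "components r = {r}"
  then show "connected_poset r"
    using disjoint_connected_components[OF assms(1)] by (auto simp: disjoint_connected_def)
qed

lemma component_eq_Restr:
  assumes "finite_poset r" "c \<in> components r"
  shows "c = Restr r (Field c)" "saturated r (Field c)"
  using component_cases[OF assms] saturated_class[OF assms(1)] by metis+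

text \<open>Supplies the decreasing measure for every recursion through components.\<close>

lemma card_component:
  assumes "finite_poset r" "\<not> connected_poset r" "c \<in> components r"
  shows "card (Field c) < card (Field r)"
proof -
  have "Field c \<subseteq> Field r"
    using component_eq_Restr[OF assms(1,3)] by (auto simp: saturated_def)
  moreover have "Field c \<noteq> Field r"
  proof
    assume "Field c = Field r"
    then have "c = r"
      using component_eq_Restr(1)[OF assms(1,3)] by (auto simp: Field_def)
    then show False
      using disjoint_connected_components[OF assms(1)] assms by (auto simp: disjoint_connected_def)
  qed
  ultimately show ?thesis
    using finite_posetD(1)[OF assms(1)] by (intro psubset_card_mono) auto
qed

lemma finite_components: "finite_poset r \<Longrightarrow> finite (components r)"
  unfolding components_def quotient_def using finite_posetD(1) by auto

lemma finite_poset_Union: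
  assumes "disjoint_connected S" "finite S"
  shows "finite_poset (\<Union>S)"
proof (rule finite_posetI)
  have c: "finite_poset c" if "c \<in> S" for c
    using assms(1) that by (auto simp: disjoint_connected_def)
  have same: "c = d" if "c \<in> S" "d \<in> S" "x \<in> Field c" "x \<in> Field d" for c d x
    using assms(1) that by (auto simp: disjoint_connected_def)
  show "finite (Field (\<Union>S))"
    using assms(2) finite_posetD(1)[OF c] by (auto simp: Field_UN)
  show "(x, x) \<in> \<Union>S" if "x \<in> Field (\<Union>S)" for x
    using that finite_posetD(2)[OF c] by (auto simp: Field_UN)
  show "(x, z) \<in> \<Union>S" if "(x, y) \<in> \<Union>S" "(y, z) \<in> \<Union>S" for x y z
  proof -
    from that obtain c d where "c \<in> S" "(x, y) \<in> c" "d \<in> S" "(y, z) \<in> d" by auto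
    moreover from this have "c = d"
      using same[of c d y] by (auto simp: Field_def)
    ultimately show ?thesis
      using finite_posetD(3)[OF c] by blast
  qed
  show "x = y" if "(x, y) \<in> \<Union>S" "(y, x) \<in> \<Union>S" for x y
  proof -
    from that obtain c d where "c \<in> S" "(x, y) \<in> c" "d \<in> S" "(y, x) \<in> d" by auto
    moreover from this have "c = d"
      using same[of c d y] by (auto simp: Field_def)
    ultimately show ?thesis
      using finite_posetD(4)[OF c] by blast
  qed
qed

lemma connected_singleton: "connected_poset {(x, x)}"
  by (auto simp: connected_poset_def hasse_linked_def)

text \<open>The empty and the one-element posets are connected. The bound is the cardinality premise
  of the rule \<open>tri_compatible.disconnected\<close>.\<close>

lemma card_Field_disconnected:
  assumes "finite_poset r" "\<not> connected_poset r"
  shows "card (Field r) \<ge> 2"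
proof -
  have "r \<noteq> {}"
    using assms(2) by (auto simp: connected_poset_def)
  then have "card (Field r) \<noteq> 0"
    using finite_posetD(1)[OF assms(1)] Field_nonempty by auto
  moreover have "card (Field r) \<noteq> 1"
    using assms connected_singleton finite_poset_card_1 by metis
  ultimately show ?thesis by auto
qed


section \<open>Relabelling\<close>

lemma Field_relabel: "Field (relabel \<sigma> r) = \<sigma> ` Field r"
  by (force simp: relabel_def Field_def)

lemma relabelI: "(x, y) \<in> r \<Longrightarrow> (\<sigma> x, \<sigma> y) \<in> relabel \<sigma> r"
  by (force simp: relabel_def)

lemma relabelE:
  assumes "(u, v) \<in> relabel \<sigma> r"
  obtains x y where "u = \<sigma> x" "v = \<sigma> y" "(x, y) \<in> r" "x \<in> Field r" "y \<in> Field r"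
  using assms by (auto simp: relabel_def Field_def)

lemma relabel_iff:
  assumes "inj_on \<sigma> A" "Field r \<subseteq> A" "x \<in> A" "y \<in> A"
  shows "(\<sigma> x, \<sigma> y) \<in> relabel \<sigma> r \<longleftrightarrow> (x, y) \<in> r"
proof
  assume "(\<sigma> x, \<sigma> y) \<in> relabel \<sigma> r"
  then obtain u v where "\<sigma> x = \<sigma> u" "\<sigma> y = \<sigma> v" "(u, v) \<in> r" "u \<in> Field r" "v \<in> Field r"
    by (rule relabelE)
  then show "(x, y) \<in> r"
    using assms by (metis inj_onD subsetD)
qed (rule relabelI)

lemma relabel_empty_iff: "relabel \<sigma> r = {} \<longleftrightarrow> r = {}"
  by (simp add: relabel_def)

lemma relabel_id: "relabel id r = r"
  by (simp add: relabel_def prod.map_id0)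

lemma relabel_comp: "relabel (\<tau> \<circ> \<sigma>) r = relabel \<tau> (relabel \<sigma> r)"
  by (simp add: relabel_def image_comp map_prod_compose)

lemma relabel_cong:
  assumes "\<And>x. x \<in> Field r \<Longrightarrow> \<sigma> x = \<tau> x"
  shows "relabel \<sigma> r = relabel \<tau> r"
  unfolding relabel_def by (rule image_cong) (auto intro!: assms intro: FieldI1 FieldI2)

lemma relabel_inv:
  assumes "inj_on \<sigma> A" "Field r \<subseteq> A"
  shows "relabel (inv_into A \<sigma>) (relabel \<sigma> r) = r"
proof -
  have "relabel (inv_into A \<sigma> \<circ> \<sigma>) r = relabel id r"
    by (rule relabel_cong) (use assms in \<open>auto intro: inv_into_f_f\<close>)
  then show ?thesis
    by (simp add: relabel_comp relabel_id)
qed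

lemma relabel_Un: "relabel \<sigma> (r \<union> s) = relabel \<sigma> r \<union> relabel \<sigma> s"
  by (auto simp: relabel_def)

lemma relabel_Union: "relabel \<sigma> (\<Union>S) = \<Union>(relabel \<sigma> ` S)"
  by (auto simp: relabel_def)

lemma relabel_Times: "relabel \<sigma> (A \<times> B) = \<sigma> ` A \<times> \<sigma> ` B"
  by (force simp: relabel_def)

lemma finite_poset_relabel:
  assumes inj: "inj_on \<sigma> (Field r)" and r: "finite_poset r"
  shows "finite_poset (relabel \<sigma> r)"
proof (rule finite_posetI)
  show "finite (Field (relabel \<sigma> r))"
    using finite_posetD(1)[OF r] by (simp add: Field_relabel)
  show "(x, x) \<in> relabel \<sigma> r" if "x \<in> Field (relabel \<sigma> r)" for x
    using that finite_posetD(2)[OF r] relabelI by (fastforce simp: Field_relabel)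
  show "(u, w) \<in> relabel \<sigma> r" if uv: "(u, v) \<in> relabel \<sigma> r" and vw: "(v, w) \<in> relabel \<sigma> r" for u v w
  proof -
    from uv obtain x y where 1: "u = \<sigma> x" "v = \<sigma> y" "(x, y) \<in> r" "y \<in> Field r"
      by (rule relabelE)
    from vw obtain y' z where 2: "v = \<sigma> y'" "w = \<sigma> z" "(y', z) \<in> r" "y' \<in> Field r"
      by (rule relabelE)
    have "y = y'"
      using inj 1 2 by (metis inj_onD)
    then show ?thesis
      using 1 2 finite_posetD(3)[OF r] relabelI by metis
  qed
  show "u = v" if uv: "(u, v) \<in> relabel \<sigma> r" and vu: "(v, u) \<in> relabel \<sigma> r" for u v
  proof -
    from uv obtain x y where 1: "u = \<sigma> x" "v = \<sigma> y" "(x, y) \<in> r" "x \<in> Field r" "y \<in> Field r"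
      by (rule relabelE)
    then have "(y, x) \<in> r"
      using vu relabel_iff[OF inj] by auto
    then show ?thesis
      using 1 finite_posetD(4)[OF r] by metis
  qed
qed

text \<open>A saturated set of the image pulls back along \<open>\<sigma>\<close> to a saturated set
  of \<open>r\<close>, which is trivial.\<close>

lemma connected_relabel:
  assumes inj: "inj_on \<sigma> (Field r)" and r: "finite_poset r" and "connected_poset r"
  shows "connected_poset (relabel \<sigma> r)"
  unfolding connected_iff_saturated[OF finite_poset_relabel[OF inj r]]
proof (intro allI impI)
  fix U assume U: "saturated (relabel \<sigma> r) U"
  let ?V = "{x \<in> Field r. \<sigma> x \<in> U}"
  have "saturated r ?V"
    unfolding saturated_def
  proof (intro conjI allI impI)
    fix x y assume xy: "(x, y) \<in> r"
    then have "\<sigma> x \<in> U \<longleftrightarrow> \<sigma> y \<in> U"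
      using U relabelI[OF xy, of \<sigma>] by (auto simp: saturated_def)
    then show "x \<in> ?V \<longleftrightarrow> y \<in> ?V"
      using xy by (auto simp: Field_def)
  qed auto
  then have "?V = {} \<or> ?V = Field r"
    using assms(3) connected_iff_saturated[OF r] by auto
  moreover have "U = \<sigma> ` ?V"
    using U by (auto simp: saturated_def Field_relabel)
  ultimately show "U = {} \<or> U = Field (relabel \<sigma> r)"
    by (auto simp: Field_relabel)
qed

lemma connected_relabel_iff:
  assumes inj: "inj_on \<sigma> (Field r)" and r: "finite_poset r"
  shows "connected_poset (relabel \<sigma> r) \<longleftrightarrow> connected_poset r"
proof
  let ?\<tau> = "inv_into (Field r) \<sigma>"
  have "inj_on ?\<tau> (Field (relabel \<sigma> r))"
    using inj_on_inv_into[of "\<sigma> ` Field r" \<sigma> "Field r"] by (simp add: Field_relabel)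
  moreover assume "connected_poset (relabel \<sigma> r)"
  ultimately have "connected_poset (relabel ?\<tau> (relabel \<sigma> r))"
    using finite_poset_relabel[OF inj r] connected_relabel by blast
  then show "connected_poset r"
    by (simp add: relabel_inv[OF inj])
qed (rule connected_relabel[OF inj r])

text \<open>The relabelled components form a \<open>disjoint_connected\<close> family with union
  \<open>relabel \<sigma> r\<close>, so \<open>components_Union\<close> applies and no linked class
  has to be computed.\<close>

lemma components_relabel:
  assumes inj: "inj_on \<sigma> (Field r)" and r: "finite_poset r"
  shows "components (relabel \<sigma> r) = relabel \<sigma> ` components r"
proof -
  note dc = disjoint_connected_components[OF r]
  have sub: "Field c \<subseteq> Field r" if "c \<in> components r" for c
    using component_eq_Restr(2)[OF r that] by (auto simp: saturated_def)
  have "disjoint_connected (relabel \<sigma> ` components r)"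
    unfolding disjoint_connected_def
  proof (intro conjI ballI impI)
    fix d assume "d \<in> relabel \<sigma> ` components r"
    then obtain c where c: "c \<in> components r" "d = relabel \<sigma> c" by auto
    have *: "inj_on \<sigma> (Field c)" "finite_poset c" "c \<noteq> {}" "connected_poset c"
      using inj_on_subset[OF inj sub[OF c(1)]] dc c(1) by (auto simp: disjoint_connected_def)
    show "finite_poset d" "connected_poset d" "d \<noteq> {}"
      using finite_poset_relabel[OF *(1,2)] connected_relabel[OF *(1,2,4)] *(3) c(2)
      by (auto simp: relabel_def)
  next
    fix d d' assume "d \<in> relabel \<sigma> ` components r" "d' \<in> relabel \<sigma> ` components r"
      and ne: "Field d \<inter> Field d' \<noteq> {}"
    then obtain c c' where c: "c \<in> components r" "d = relabel \<sigma> c"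
        "c' \<in> components r" "d' = relabel \<sigma> c'"
      by auto
    from ne obtain x x' where x: "x \<in> Field c" "x' \<in> Field c'" "\<sigma> x = \<sigma> x'"
      unfolding c Field_relabel by auto
    then have "x = x'"
      using inj sub[OF c(1)] sub[OF c(3)] by (metis inj_onD subsetD)
    then have "c = c'"
      using dc c x by (auto simp: disjoint_connected_def)
    then show "d = d'"
      using c by simp
  qed
  moreover have "\<Union>(relabel \<sigma> ` components r) = relabel \<sigma> r"
    using relabel_Union[of \<sigma> "components r"] Union_components[OF r] by simp
  ultimately show ?thesis
    using components_Union[of "relabel \<sigma> ` components r"] finite_poset_relabel[OF inj r] by simp
qed

lemma min_elts_relabel:
  assumes "inj_on \<sigma> (Field r)"
  shows "min_elts (relabel \<sigma> r) = \<sigma> ` min_elts r"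
proof
  show "min_elts (relabel \<sigma> r) \<subseteq> \<sigma> ` min_elts r"
  proof
    fix u assume u: "u \<in> min_elts (relabel \<sigma> r)"
    then obtain x where x: "x \<in> Field r" "u = \<sigma> x"
      by (auto simp: min_elts_def Field_relabel)
    have "y = x" if "(y, x) \<in> r" for y
    proof -
      have "\<sigma> y = \<sigma> x"
        using u x relabelI[OF that, of \<sigma>] by (auto simp: min_elts_def)
      then show ?thesis
        using assms x(1) that by (auto simp: Field_def dest: inj_onD)
    qed
    then show "u \<in> \<sigma> ` min_elts r"
      using x by (auto simp: min_elts_def)
  qed
  show "\<sigma> ` min_elts r \<subseteq> min_elts (relabel \<sigma> r)"
  proof
    fix u assume "u \<in> \<sigma> ` min_elts r"
    then obtain x where x: "x \<in> min_elts r" "u = \<sigma> x" by auto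
    have "v = u" if "(v, u) \<in> relabel \<sigma> r" for v
      using that
    proof (rule relabelE)
      fix y z assume *: "v = \<sigma> y" "u = \<sigma> z" "(y, z) \<in> r" "z \<in> Field r"
      then have "z = x"
        using x assms by (auto simp: min_elts_def dest: inj_onD)
      then show "v = u"
        using x * by (auto simp: min_elts_def)
    qed
    then show "u \<in> min_elts (relabel \<sigma> r)"
      using x by (auto simp: min_elts_def Field_relabel)
  qed
qed

lemma relabel_down_prod: "relabel \<sigma> (r \<down> s) = relabel \<sigma> r \<down> relabel \<sigma> s"
  by (simp add: down_prod_def relabel_Un relabel_Times Field_relabel)

lemma relabel_tri_prod:
  "inj_on \<sigma> (Field s) \<Longrightarrow> relabel \<sigma> (r \<triangledown> s) = relabel \<sigma> r \<triangledown> relabel \<sigma> s"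
  by (simp add: tri_prod_def relabel_Un relabel_Times Field_relabel min_elts_relabel)


section \<open>Classes of posets with unique decompositions\<close>

text \<open>Common form of the factorization for both products: \<open>f\<close> is
  \<open>\<down>\<close> or \<open>\<triangledown>\<close>. Nonemptiness of the factors is meant to
  be part of \<open>P\<close>.\<close>

definition decomposition ::
  "('a rel \<Rightarrow> bool) \<Rightarrow> ('a rel \<Rightarrow> 'a rel \<Rightarrow> 'a rel) \<Rightarrow> 'a rel \<Rightarrow> 'a rel \<Rightarrow> 'a rel \<Rightarrow> bool" where
  "decomposition P f r r1 r2 \<longleftrightarrow>
     P r1 \<and> P r2 \<and> Field r1 \<inter> Field r2 = {} \<and>
     (\<not> connected_poset r2 \<or> card (Field r2) = 1) \<and> r = f r1 r2"

text \<open>\<open>f\<close> is the product taken apart, \<open>g\<close> the product put in its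
  place.\<close>

definition recursion ::
  "('a rel \<Rightarrow> bool) \<Rightarrow> ('a rel \<Rightarrow> 'a rel \<Rightarrow> 'a rel) \<Rightarrow> ('a rel \<Rightarrow> 'a rel \<Rightarrow> 'a rel) \<Rightarrow>
     ('a rel \<Rightarrow> 'a rel) \<Rightarrow> bool" where
  "recursion P f g \<theta> \<longleftrightarrow>
     (\<forall>x. \<theta> {(x, x)} = {(x, x)}) \<and>
     (\<forall>r. P r \<and> \<not> connected_poset r \<longrightarrow> \<theta> r = (\<Union>c\<in>components r. \<theta> c)) \<and>
     (\<forall>r r1 r2. decomposition P f r r1 r2 \<longrightarrow> \<theta> r = g (\<theta> r1) (\<theta> r2))"

text \<open>The axioms say that the class is freely generated by singletons, disjoint unions and
  products \<open>f\<close> with an irreducible second factor. The construction of the bijection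
  uses nothing else about the two kinds of posets.\<close>

locale poset_class =
  fixes P :: "'a rel \<Rightarrow> bool" and f :: "'a rel \<Rightarrow> 'a rel \<Rightarrow> 'a rel"
  assumes poset: "P r \<Longrightarrow> finite_poset r"
    and nonempty: "P r \<Longrightarrow> r \<noteq> {}"
    and singleton: "P {(x, x)}"
    and components_iff:
      "finite_poset r \<Longrightarrow> \<not> connected_poset r \<Longrightarrow> P r \<longleftrightarrow> (\<forall>c\<in>components r. P c)"
    and composite: "decomposition P f r r1 r2 \<Longrightarrow>
      P r \<and> connected_poset r \<and> Field r = Field r1 \<union> Field r2"
    and decomposition_exists:
      "P r \<Longrightarrow> connected_poset r \<Longrightarrow> card (Field r) > 1 \<Longrightarrow> \<exists>r1 r2. decomposition P f r r1 r2"
    and decomposition_unique: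
      "decomposition P f r r1 r2 \<Longrightarrow> decomposition P f r s1 s2 \<Longrightarrow> s1 = r1 \<and> s2 = r2"
begin

lemma card_pos: "P r \<Longrightarrow> card (Field r) > 0"
  using finite_posetD(1)[OF poset] Field_nonempty[OF nonempty] by (simp add: card_gt_0_iff)

lemma card_decomposition:
  assumes "decomposition P f r r1 r2"
  shows "card (Field r) = card (Field r1) + card (Field r2)"
    "card (Field r1) < card (Field r)" "card (Field r2) < card (Field r)"
proof -
  have *: "P r1" "P r2" "Field r1 \<inter> Field r2 = {}" "Field r = Field r1 \<union> Field r2"
    using assms composite[OF assms] by (auto simp: decomposition_def)
  show "card (Field r) = card (Field r1) + card (Field r2)"
    unfolding *(4) using * finite_posetD(1)[OF poset] by (intro card_Un_disjoint) auto
  then show "card (Field r1) < card (Field r)" "card (Field r2) < card (Field r)"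
    using card_pos * by auto
qed

lemma connected_cases:
  assumes "P r" "connected_poset r"
  obtains x where "r = {(x, x)}" | r1 r2 where "decomposition P f r r1 r2"
proof (cases "card (Field r) = 1")
  case True
  then show ?thesis
    using finite_poset_card_1[OF poset[OF assms(1)]] that(1) by blast
next
  case False
  then have "card (Field r) > 1"
    using card_pos[OF assms(1)] by auto
  then show ?thesis
    using decomposition_exists assms that(2) by blast
qed

lemma poset_class_induct [consumes 1, case_names singleton disconnected composite]:
  assumes "P r"
    and "\<And>x. Q {(x, x)}"
    and "\<And>r. P r \<Longrightarrow> \<not> connected_poset r \<Longrightarrow> (\<And>c. c \<in> components r \<Longrightarrow> P c) \<Longrightarrow>
      (\<And>c. c \<in> components r \<Longrightarrow> Q c) \<Longrightarrow> Q r"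
    and "\<And>r r1 r2. decomposition P f r r1 r2 \<Longrightarrow> Q r1 \<Longrightarrow> Q r2 \<Longrightarrow> Q r"
  shows "Q r"
  using assms(1)
proof (induction "card (Field r)" arbitrary: r rule: less_induct)
  case less
  show ?case
  proof (cases "connected_poset r")
    case True
    show ?thesis
      using less.prems True
    proof (cases rule: connected_cases)
      case (2 r1 r2)
      then have "P r1" "P r2"
        by (auto simp: decomposition_def)
      then show ?thesis
        using assms(4)[OF 2] less.hyps card_decomposition[OF 2] by blast
    qed (use assms(2) in simp)
  next
    case False
    then have "P c" if "c \<in> components r" for c
      using components_iff[OF poset] less.prems that by blast
    then show ?thesis
      using assms(3)[OF less.prems False] less.hyps card_component[OF poset[OF less.prems] False]
      by blast
  qed
qed

end

text \<open>
  The comparisons of cardinalities make the recursion terminate for arbitrary \<open>P\<close> and \<open>f\<close>; they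
  hold automatically in a \<^locale>\<open>poset_class\<close>.
\<close>

function transfer ::
  "('a rel \<Rightarrow> bool) \<Rightarrow> ('a rel \<Rightarrow> 'a rel \<Rightarrow> 'a rel) \<Rightarrow> ('a rel \<Rightarrow> 'a rel \<Rightarrow> 'a rel) \<Rightarrow>
     'a rel \<Rightarrow> 'a rel" where
  "transfer P f g r =
    (if \<forall>c\<in>components r. card (Field c) < card (Field r)
     then \<Union>c\<in>components r. transfer P f g c
     else if \<exists>r1 r2. decomposition P f r r1 r2 \<and>
       card (Field r1) < card (Field r) \<and> card (Field r2) < card (Field r)
     then let p = SOME p. decomposition P f r (fst p) (snd p) \<and>
       card (Field (fst p)) < card (Field r) \<and> card (Field (snd p)) < card (Field r)
       in g (transfer P f g (fst p)) (transfer P f g (snd p))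
     else r)"
  by pat_completeness auto
termination
proof (relation "measure (\<lambda>(P, f, g, r). card (Field r))", goal_cases)
  case (3 P f g r p)
  then have "\<exists>p. decomposition P f r (fst p) (snd p) \<and>
       card (Field (fst p)) < card (Field r) \<and> card (Field (snd p)) < card (Field r)"
    by simp
  from someI_ex[OF this] show ?case
    using 3 by simp
next
  case (4 P f g r p)
  then have "\<exists>p. decomposition P f r (fst p) (snd p) \<and>
       card (Field (fst p)) < card (Field r) \<and> card (Field (snd p)) < card (Field r)"
    by simp
  from someI_ex[OF this] show ?case
    using 4 by simp
qed auto

declare transfer.simps [simp del]

context poset_class
begin

text \<open>On the posets of the class, the test on components in \<open>transfer\<close> succeeds
  exactly for the disconnected ones, and uniqueness of decompositions makes the choice by
  \<open>SOME\<close> immaterial.\<close>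

lemma recursion_transfer: "recursion P f g (transfer P f g)"
  unfolding recursion_def
proof (intro conjI allI impI)
  have conn: "\<not> (\<forall>c\<in>components r. card (Field c) < card (Field r))"
    if "finite_poset r" "r \<noteq> {}" "connected_poset r" for r :: "'a rel"
    using connected_iff_components[OF that(1,2)] that(3) by auto
  show "transfer P f g {(x, x)} = {(x, x)}" for x
  proof -
    \<comment> \<open>Two nonempty disjoint factors need two points, so on a singleton
      \<open>transfer\<close> reaches its default value \<open>r\<close>.\<close>
    have "\<not> decomposition P f {(x, x)} r1 r2" for r1 r2
    proof
      assume *: "decomposition P f {(x, x)} r1 r2"
      then have "card (Field {(x, x)}) = card (Field r1) + card (Field r2)" "P r1" "P r2"
        using card_decomposition(1)[OF *] by (auto simp: decomposition_def)
      then show False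
        using card_pos[of r1] card_pos[of r2] by simp
    qed
    then show ?thesis
      using conn[OF finite_poset_singleton _ connected_singleton, of x]
      by (subst transfer.simps) (simp only: insert_not_empty if_False simp_thms)
  qed
  show "transfer P f g r = (\<Union>c\<in>components r. transfer P f g c)"
    if "P r \<and> \<not> connected_poset r" for r
    using card_component[OF poset] that by (subst transfer.simps) auto
  show "transfer P f g r = g (transfer P f g r1) (transfer P f g r2)"
    if D: "decomposition P f r r1 r2" for r r1 r2
  proof -
    have "P r" "connected_poset r"
      using composite[OF D] by auto
    then have nc: "\<not> (\<forall>c\<in>components r. card (Field c) < card (Field r))"
      using conn poset nonempty by blast
    have "(SOME p. decomposition P f r (fst p) (snd p) \<and>
       card (Field (fst p)) < card (Field r) \<and> card (Field (snd p)) < card (Field r)) = (r1, r2)"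
    proof (rule some_equality)
      fix p assume "decomposition P f r (fst p) (snd p) \<and>
        card (Field (fst p)) < card (Field r) \<and> card (Field (snd p)) < card (Field r)"
      then show "p = (r1, r2)"
        using decomposition_unique[OF D] by (metis prod.collapse)
    qed (use D card_decomposition[OF D] in simp)
    moreover have "\<exists>r1 r2. decomposition P f r r1 r2 \<and>
       card (Field r1) < card (Field r) \<and> card (Field r2) < card (Field r)"
      using D card_decomposition[OF D] by blast
    ultimately show ?thesis
      using nc by (subst transfer.simps) (simp only: if_True if_False Let_def fst_conv snd_conv)
  qed
qed

end

section \<open>Transport between two classes\<close>

locale poset_class_pair = source: poset_class P f + target: poset_class Q g
  for P :: "'a rel \<Rightarrow> bool" and f and Q :: "'a rel \<Rightarrow> bool" and g
begin

text \<open>The hypothesis \<open>image\<close> is what the induction in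
  \<open>recursion_image\<close> knows about components at this stage. As \<open>\<theta>\<close>
  keeps their fields, their images are again a \<open>disjoint_connected\<close> family.\<close>

lemma recursion_disconnected:
  assumes \<theta>: "recursion P f g \<theta>" and r: "P r" "\<not> connected_poset r"
    and image: "\<And>c. c \<in> components r \<Longrightarrow> Q (\<theta> c) \<and> Field (\<theta> c) = Field c \<and> connected_poset (\<theta> c)"
  shows "components (\<theta> r) = \<theta> ` components r" "finite_poset (\<theta> r)"
proof -
  note poset_r = source.poset[OF r(1)]
  note dc = disjoint_connected_components[OF poset_r]
  have \<theta>r: "\<theta> r = \<Union>(\<theta> ` components r)"
    using \<theta> r by (auto simp: recursion_def)
  have S: "disjoint_connected (\<theta> ` components r)"
    unfolding disjoint_connected_def
  proof (intro conjI ballI impI)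
    fix d assume "d \<in> \<theta> ` components r"
    then obtain c where "c \<in> components r" "d = \<theta> c" by auto
    then show "finite_poset d" "d \<noteq> {}" "connected_poset d"
      using image target.poset target.nonempty by auto
  next
    fix d d' assume "d \<in> \<theta> ` components r" "d' \<in> \<theta> ` components r"
      and ne: "Field d \<inter> Field d' \<noteq> {}"
    then obtain c c' where c: "c \<in> components r" "d = \<theta> c" "c' \<in> components r" "d' = \<theta> c'"
      by auto
    then have "Field c \<inter> Field c' \<noteq> {}"
      using image[OF c(1)] image[OF c(3)] ne by simp
    then have "c = c'"
      using dc c(1,3) by (simp add: disjoint_connected_def)
    then show "d = d'"
      using c by simp
  qed
  show "finite_poset (\<theta> r)"
    using finite_poset_Union[OF S] finite_components[OF poset_r] \<theta>r by simp
  then show "components (\<theta> r) = \<theta> ` components r"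
    using components_Union[OF S] \<theta>r by simp
qed

lemma recursion_image:
  assumes \<theta>: "recursion P f g \<theta>" and "P r"
  shows "Q (\<theta> r) \<and> Field (\<theta> r) = Field r \<and> (connected_poset (\<theta> r) \<longleftrightarrow> connected_poset r)"
  using \<open>P r\<close>
proof (induction rule: source.poset_class_induct)
  case (singleton x)
  then show ?case
    using \<theta> target.singleton by (simp add: recursion_def)
next
  case (disconnected r)
  note r = source.poset[OF disconnected(1)]
  have image: "Q (\<theta> c) \<and> Field (\<theta> c) = Field c \<and> connected_poset (\<theta> c)" if "c \<in> components r" for c
    using disconnected.IH[OF that] disjoint_connected_components[OF r] that
    by (simp add: disjoint_connected_def)
  note comps = recursion_disconnected[OF \<theta> disconnected(1,2) image]
  have "\<theta> r = \<Union>(\<theta> ` components r)"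
    using \<theta> disconnected by (auto simp: recursion_def)
  then have "Field (\<theta> r) = (\<Union>c\<in>components r. Field (\<theta> c))"
    by (simp add: Field_UN)
  also have "\<dots> = Field (\<Union>(components r))"
    using image by (simp add: Field_UN)
  finally have Field: "Field (\<theta> r) = Field r"
    using Union_components[OF r] by simp
  \<comment> \<open>Otherwise \<open>\<theta> r\<close> would be its own only component, hence the
    image of some component \<open>c\<close>, and \<open>c\<close> would contain all points of
    \<open>r\<close>.\<close>
  have nconn: "\<not> connected_poset (\<theta> r)"
  proof
    assume conn: "connected_poset (\<theta> r)"
    have "\<theta> r \<noteq> {}"
      using Field Field_nonempty[OF source.nonempty[OF disconnected(1)]] by auto
    then have "\<theta> ` components r = {\<theta> r}"
      using conn connected_iff_components comps by metis
    then obtain c where c: "c \<in> components r" "\<theta> c = \<theta> r"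
      by (metis imageE singletonI)
    then have "Field c = Field r"
      using image Field by metis
    then show False
      using card_component[OF r disconnected(2) c(1)] by simp
  qed
  then have "Q (\<theta> r)"
    using target.components_iff[OF comps(2)] comps(1) image by auto
  then show ?case
    using disconnected(2) Field nconn by auto
next
  case (composite r r1 r2)
  \<comment> \<open>Preservation of fields gives disjointness; together with preservation of
    connectedness it gives the condition on the second factor.\<close>
  have "decomposition Q g (\<theta> r) (\<theta> r1) (\<theta> r2)"
    using \<theta> composite by (auto simp: decomposition_def recursion_def)
  then show ?case
    using composite source.composite[OF composite(1)] target.composite by metis
qed

lemma recursion_decomposition:
  assumes "recursion P f g \<theta>" "decomposition P f r r1 r2"
  shows "decomposition Q g (\<theta> r) (\<theta> r1) (\<theta> r2)"
  using assms recursion_image[OF assms(1)] by (auto simp: decomposition_def recursion_def)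

lemma recursion_components:
  assumes \<theta>: "recursion P f g \<theta>" and r: "P r" "\<not> connected_poset r"
  shows "components (\<theta> r) = \<theta> ` components r"
proof (rule recursion_disconnected(1)[OF \<theta> r])
  fix c assume c: "c \<in> components r"
  then have "P c"
    using source.components_iff[OF source.poset] r by blast
  then show "Q (\<theta> c) \<and> Field (\<theta> c) = Field c \<and> connected_poset (\<theta> c)"
    using recursion_image[OF \<theta>] disjoint_connected_components[OF source.poset[OF r(1)]] c
    by (simp add: disjoint_connected_def)
qed

text \<open>\<open>\<theta>\<close> carries components to components and decompositions to
  decompositions, so \<open>\<eta>\<close> takes apart precisely what \<open>\<theta>\<close> has
  put together.\<close>

lemma recursion_inverse:
  assumes \<theta>: "recursion P f g \<theta>" and \<eta>: "recursion Q g f \<eta>" and "P r"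
  shows "\<eta> (\<theta> r) = r"
  using \<open>P r\<close>
proof (induction rule: source.poset_class_induct)
  case (singleton x)
  then show ?case
    using \<theta> \<eta> by (simp add: recursion_def)
next
  case (disconnected r)
  have "\<eta> (\<theta> r) = \<Union>(\<eta> ` components (\<theta> r))"
    using \<eta> recursion_image[OF \<theta> disconnected(1)] disconnected(2) by (auto simp: recursion_def)
  also have "\<dots> = \<Union>(components r)"
    using recursion_components[OF \<theta> disconnected(1,2)] disconnected.IH by auto
  finally show ?case
    using Union_components[OF source.poset[OF disconnected(1)]] by simp
next
  case (composite r r1 r2)
  have "\<eta> (\<theta> r) = f (\<eta> (\<theta> r1)) (\<eta> (\<theta> r2))"
    using recursion_decomposition[OF \<theta> composite(1)] \<eta> by (auto simp: recursion_def)
  then show ?case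
    using composite by (simp add: decomposition_def)
qed

lemma recursion_bij_betw:
  assumes \<theta>: "recursion P f g \<theta>"
  shows "bij_betw \<theta> {r. P r \<and> Field r = A} {r. Q r \<and> Field r = A}"
proof -
  \<comment> \<open>The assumptions are symmetric in the two classes, so every result also holds
    with source and target exchanged.\<close>
  interpret swapped: poset_class_pair Q g P f ..
  let ?\<eta> = "transfer Q g f"
  note \<eta> = target.recursion_transfer[of f]
  show ?thesis
    by (rule bij_betw_byWitness[where f' = ?\<eta>])
      (use recursion_inverse[OF \<theta> \<eta>] swapped.recursion_inverse[OF \<eta> \<theta>]
         recursion_image[OF \<theta>] swapped.recursion_image[OF \<eta>] in auto)
qed

end


section \<open>WN posets\<close>

text \<open>Pointwise exclusion of N with only three of its non-relations spelled out: in a poset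
  the others follow by transitivity, and distinctness of the four points by reflexivity.\<close>

definition N_free :: "'a rel \<Rightarrow> bool" where
  "N_free r \<longleftrightarrow> (\<forall>x y z t. (x, z) \<in> r \<longrightarrow> (y, z) \<in> r \<longrightarrow> (y, t) \<in> r \<longrightarrow>
     (x, t) \<in> r \<or> (y, x) \<in> r \<or> (t, z) \<in> r)"

lemma N_freeD:
  "N_free r \<Longrightarrow> (x, z) \<in> r \<Longrightarrow> (y, z) \<in> r \<Longrightarrow> (y, t) \<in> r \<Longrightarrow> (x, t) \<notin> r \<Longrightarrow> (y, x) \<notin> r \<Longrightarrow> (t, z) \<in> r"
  unfolding N_free_def by blast

lemma Field_N_poset: "Field N_poset = {0, 1, 2, 3}"
  by (auto simp: N_poset_def Field_def)

lemma WN_iff: "WN r \<longleftrightarrow> finite_poset r \<and> N_free r"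
proof -
  have "(\<exists>B\<subseteq>Field r. poset_isomorphic (Restr r B) N_poset) \<longleftrightarrow> \<not> N_free r" if r: "finite_poset r"
  proof
    assume "\<exists>B\<subseteq>Field r. poset_isomorphic (Restr r B) N_poset"
    then obtain B h where B: "B \<subseteq> Field r" and h: "bij_betw h B {0, 1, 2, 3 :: nat}"
      and iso: "\<And>x y. x \<in> B \<Longrightarrow> y \<in> B \<Longrightarrow> (x, y) \<in> r \<longleftrightarrow> (h x, h y) \<in> N_poset"
      unfolding poset_isomorphic_def Field_N_poset using Field_Restr[OF r] by auto
    have "\<exists>x\<in>B. h x = i" if "i \<in> {0, 1, 2, 3}" for i
      using h that by (metis bij_betw_imp_surj_on imageE)
    then obtain x y z t where "x \<in> B" "h x = 0" "y \<in> B" "h y = 1" "z \<in> B" "h z = 2" "t \<in> B" "h t = 3"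
      by (metis insertCI)
    then have "(x, z) \<in> r" "(y, z) \<in> r" "(y, t) \<in> r" "(x, t) \<notin> r" "(y, x) \<notin> r" "(t, z) \<notin> r"
      using iso by (simp_all add: N_poset_def Id_on_iff)
    then show "\<not> N_free r"
      unfolding N_free_def by blast
  next
    assume "\<not> N_free r"
    then obtain x y z t where N: "(x, z) \<in> r" "(y, z) \<in> r" "(y, t) \<in> r"
        "(x, t) \<notin> r" "(y, x) \<notin> r" "(t, z) \<notin> r"
      unfolding N_free_def by blast
    have B: "{x, y, z, t} \<subseteq> Field r"
      using N by (auto simp: Field_def)
    have refl: "(x, x) \<in> r" "(y, y) \<in> r" "(z, z) \<in> r" "(t, t) \<in> r"
      using finite_posetD(2)[OF r] B by auto
    note trans = finite_posetD(3)[OF r]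
    \<comment> \<open>Each of these relations would produce, by transitivity, one that
      \<open>N\<close> denies.\<close>
    have neg: "(x, y) \<notin> r" "(t, x) \<notin> r" "(z, x) \<notin> r" "(z, y) \<notin> r" "(t, y) \<notin> r" "(z, t) \<notin> r"
      using N trans by blast+
    have ne: "x \<noteq> y" "x \<noteq> z" "x \<noteq> t" "y \<noteq> z" "y \<noteq> t" "z \<noteq> t"
      using N refl neg by auto
    let ?h = "\<lambda>w. if w = x then 0 else if w = y then 1 else if w = z then 2 else (3 :: nat)"
    have "bij_betw ?h {x, y, z, t} {0, 1, 2, 3}"
      using ne by (auto simp: bij_betw_def inj_on_def)
    moreover have "\<forall>u\<in>{x, y, z, t}. \<forall>v\<in>{x, y, z, t}. (u, v) \<in> r \<longleftrightarrow> (?h u, ?h v) \<in> N_poset"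
      using N refl neg ne by (simp add: N_poset_def Id_on_iff)
    ultimately have "poset_isomorphic (Restr r {x, y, z, t}) N_poset"
      unfolding poset_isomorphic_def Field_N_poset Field_Restr[OF r B]
      by (intro exI[of _ ?h]) auto
    then show "\<exists>B\<subseteq>Field r. poset_isomorphic (Restr r B) N_poset"
      using B by blast
  qed
  then show ?thesis
    unfolding WN_def by blast
qed

lemma N_free_Restr: "N_free r \<Longrightarrow> N_free (Restr r U)"
  unfolding N_free_def by blast

lemma WN_Restr: "WN r \<Longrightarrow> WN (Restr r U)"
  by (simp add: WN_iff N_free_Restr finite_poset_Restr)

lemma WN_relabel:
  assumes inj: "inj_on \<sigma> (Field r)" and "WN r"
  shows "WN (relabel \<sigma> r)"
  unfolding WN_iff
proof
  show "finite_poset (relabel \<sigma> r)"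
    using assms finite_poset_relabel by (auto simp: WN_iff)
  show "N_free (relabel \<sigma> r)"
    unfolding N_free_def
  proof (intro allI impI)
    fix x y z t assume N: "(x, z) \<in> relabel \<sigma> r" "(y, z) \<in> relabel \<sigma> r" "(y, t) \<in> relabel \<sigma> r"
    then have "x \<in> \<sigma> ` Field r" "y \<in> \<sigma> ` Field r" "z \<in> \<sigma> ` Field r" "t \<in> \<sigma> ` Field r"
      unfolding Field_relabel[symmetric] by (auto simp: Field_def)
    then obtain x' y' z' t' where *: "x = \<sigma> x'" "y = \<sigma> y'" "z = \<sigma> z'" "t = \<sigma> t'"
        and **: "x' \<in> Field r" "y' \<in> Field r" "z' \<in> Field r" "t' \<in> Field r"
      by auto
    have "N_free r"
      using assms(2) by (simp add: WN_iff)
    then show "(x, t) \<in> relabel \<sigma> r \<or> (y, x) \<in> relabel \<sigma> r \<or> (t, z) \<in> relabel \<sigma> r"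
      using N ** relabel_iff[OF inj order_refl] unfolding * N_free_def by blast
  qed
qed

text \<open>N is connected: \<open>x\<close>, \<open>z\<close>, \<open>y\<close>, \<open>t\<close>
  are linked one after another, so a copy of N lies inside a single component.\<close>

lemma WN_iff_components:
  assumes r: "finite_poset r"
  shows "WN r \<longleftrightarrow> (\<forall>c\<in>components r. WN c)"
proof
  assume "WN r"
  then show "\<forall>c\<in>components r. WN c"
    using WN_Restr component_eq_Restr(1)[OF r] by metis
next
  assume *: "\<forall>c\<in>components r. WN c"
  have "N_free r"
    unfolding N_free_def
  proof (intro allI impI)
    fix x y z t assume N: "(x, z) \<in> r" "(y, z) \<in> r" "(y, t) \<in> r"
    then have "(x, z) \<in> \<Union>(components r)"
      by (simp add: Union_components[OF r])
    then obtain c where c: "c \<in> components r" "(x, z) \<in> c"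
      by blast
    then have "x \<in> Field c" "z \<in> Field c"
      by (auto simp: Field_def)
    moreover from this have "y \<in> Field c"
      using component_eq_Restr(2)[OF r c(1)] N(2) unfolding saturated_def by blast
    moreover from this have "t \<in> Field c"
      using component_eq_Restr(2)[OF r c(1)] N(3) unfolding saturated_def by blast
    ultimately have "(y, z) \<in> c" "(y, t) \<in> c"
      using component_eq_Restr(1)[OF r c(1)] N by blast+
    moreover have "N_free c"
      using * c(1) by (auto simp: WN_iff)
    ultimately have "(x, t) \<in> c \<or> (y, x) \<in> c \<or> (t, z) \<in> c"
      using c(2) unfolding N_free_def by blast
    then show "(x, t) \<in> r \<or> (y, x) \<in> r \<or> (t, z) \<in> r"
      using component_eq_Restr(1)[OF r c(1)] by blast
  qed
  then show "WN r"
    using r by (simp add: WN_iff)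
qed

section \<open>Cuts, the possible fields of an upper factor of \<open>\<down>\<close>\<close>

definition cut :: "'a rel \<Rightarrow> 'a set \<Rightarrow> bool" where
  "cut r U \<longleftrightarrow> U \<subset> Field r \<and> U \<noteq> {} \<and> (Field r - U) \<times> U \<subseteq> r"

text \<open>Points of \<open>U\<close> are comparable with a fixed point outside \<open>U\<close>,
  points outside with a fixed point of \<open>U\<close>; a saturated set therefore contains
  everything or nothing.\<close>

lemma cut_connected:
  assumes r: "finite_poset r" and "cut r U"
  shows "connected_poset r"
  unfolding connected_iff_saturated[OF r]
proof (intro allI impI)
  fix V assume V: "saturated r V"
  from assms(2) obtain x y where "x \<in> Field r - U" "y \<in> U"
    unfolding cut_def by blast
  have cutD: "(u, v) \<in> r" if "u \<in> Field r - U" "v \<in> U" for u v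
    using assms(2) that unfolding cut_def by blast
  have satD: "u \<in> V \<longleftrightarrow> v \<in> V" if "(u, v) \<in> r" for u v
    using V that unfolding saturated_def by blast
  have "w \<in> V \<longleftrightarrow> x \<in> V" if "w \<in> Field r" for w
  proof (cases "w \<in> U")
    case True
    then show ?thesis
      using satD[OF cutD[OF \<open>x \<in> Field r - U\<close>]] by simp
  next
    case False
    then show ?thesis
      using that satD[OF cutD[OF _ \<open>y \<in> U\<close>]] \<open>x \<in> Field r - U\<close> by blast
  qed
  moreover have "V \<subseteq> Field r"
    using V by (simp add: saturated_def)
  ultimately show "V = {} \<or> V = Field r"
    by blast
qed

lemma min_elts_subset: "min_elts r \<subseteq> Field r"
  by (auto simp: min_elts_def)

lemma min_eltsD: "m \<in> min_elts r \<Longrightarrow> (x, m) \<in> r \<Longrightarrow> x = m"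
  by (auto simp: min_elts_def)

lemma ex_above_all_min:
  assumes r: "finite_poset r" "r \<noteq> {}" and N: "N_free r" and conn: "connected_poset r"
  shows "\<exists>z\<in>Field r. \<forall>x\<in>min_elts r. (x, z) \<in> r"
proof -
  note fin = finite_posetD(1)[OF r(1)] and trans = finite_posetD(3)[OF r(1)]
  \<comment> \<open>The minimal elements below a point; \<open>z\<close> will be chosen to maximize
    their number.\<close>
  let ?M = "\<lambda>z. {x \<in> min_elts r. (x, z) \<in> r}"
  have finM: "finite (?M z)" for z
    using fin min_elts_subset by (auto intro: finite_subset[of _ "min_elts r"] finite_subset)
  let ?k = "Max ((\<lambda>z. card (?M z)) ` Field r)"
  have "?k \<in> (\<lambda>z. card (?M z)) ` Field r"
    using fin Field_nonempty[OF r(2)] by (intro Max_in) auto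
  then obtain z where z: "z \<in> Field r" "card (?M z) = ?k"
    by auto
  have max: "card (?M w) \<le> card (?M z)" if "w \<in> Field r" for w
    unfolding z(2) using fin that by (intro Max_ge) auto
  \<comment> \<open>The up-set generated by \<open>?M z\<close>. Once it is closed downwards as
    well, connectedness makes it the whole poset, and a minimal element in it can only be a member
    of \<open>?M z\<close>.\<close>
  let ?W = "{w \<in> Field r. \<exists>y \<in> ?M z. (y, w) \<in> r}"
  have down: "v \<in> ?W" if wW: "w \<in> ?W" and vw: "(v, w) \<in> r" for v w
  proof -
    have v: "v \<in> Field r"
      using vw by (auto simp: Field_def)
    from wW obtain y where y: "y \<in> ?M z" "(y, w) \<in> r" "w \<in> Field r"
      by auto
    obtain m where m: "m \<in> min_elts r" "(m, v) \<in> r"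
      by (rule ex_min_below[OF r(1) v])
    then have mw: "(m, w) \<in> r"
      using vw trans by blast
    \<comment> \<open>Otherwise \<open>w\<close> would beat \<open>z\<close>. It is above
      \<open>m\<close>, and above every \<open>x\<close> in \<open>?M z\<close>: without
      \<open>x \<le> w\<close>, N-freeness for \<open>x < z > y < w\<close> forces
      \<open>w \<le> z\<close>, hence \<open>m \<le> z\<close>.\<close>
    have "(m, z) \<in> r"
    proof (rule ccontr)
      assume mz: "(m, z) \<notin> r"
      have "(x, w) \<in> r" if x: "x \<in> ?M z" for x
      proof (rule ccontr)
        assume xw: "(x, w) \<notin> r"
        have "(y, x) \<notin> r"
          using min_eltsD[of x r y] x y xw by auto
        then have "(w, z) \<in> r"
          using N_freeD[OF N, of x z y w] x y xw by blast
        then show False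
          using trans[OF mw] mz by blast
      qed
      then have "?M z \<subset> ?M w"
        using m mw mz by blast
      then have "card (?M z) < card (?M w)"
        using finM by (intro psubset_card_mono)
      then show False
        using max[OF y(3)] by simp
    qed
    then show "v \<in> ?W"
      using m v by blast
  qed
  have up: "w \<in> ?W" if "v \<in> ?W" "(v, w) \<in> r" for v w
    using that trans by (auto simp: Field_def)
  have "saturated r ?W"
    unfolding saturated_def
  proof (intro conjI allI impI iffI)
    show "y \<in> ?W" if "(x, y) \<in> r" "x \<in> ?W" for x y
      using up that by blast
    show "x \<in> ?W" if "(x, y) \<in> r" "y \<in> ?W" for x y
      using down that by blast
  qed simp
  moreover have "?W \<noteq> {}"
  proof -
    obtain m where m: "m \<in> min_elts r" "(m, z) \<in> r"
      by (rule ex_min_below[OF r(1) z(1)])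
    then have "z \<in> ?W"
      using z(1) by auto
    then show ?thesis by blast
  qed
  ultimately have W: "?W = Field r"
    by (rule connected_saturated[OF r(1) conn])
  have "(x, z) \<in> r" if "x \<in> min_elts r" for x
  proof -
    have "x \<in> ?W"
      unfolding W using that by (simp add: min_elts_def)
    then show ?thesis
      using min_eltsD[OF that] by auto
  qed
  then show ?thesis
    using z(1) by blast
qed

lemma cut_above_min:
  assumes "WN r" "connected_poset r" "card (Field r) > 1"
  shows "cut r (above_min r)"
proof -
  have r: "finite_poset r" "N_free r"
    using assms(1) by (auto simp: WN_iff)
  have ne: "r \<noteq> {}"
    using assms(3) by auto
  obtain z where z: "z \<in> Field r" "\<And>x. x \<in> min_elts r \<Longrightarrow> (x, z) \<in> r"
    using ex_above_all_min[OF r(1) ne r(2) assms(2)] by blast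
  obtain m where m: "m \<in> min_elts r" "(m, z) \<in> r"
    by (rule ex_min_below[OF r(1) z(1)])
  have "above_min r \<noteq> {}"
  \<comment> \<open>\<open>above_min\<close> asks for strict inequalities, so a minimal
    \<open>z\<close> is not in it; but such a \<open>z\<close> is the least element, and any other
    point will do.\<close>
  proof (cases "z \<in> min_elts r")
    case True
    have "\<not> Field r \<subseteq> {z}"
      using assms(3) by (metis card.empty card_1_singleton_iff less_numeral_extra(3)
          nat_neq_iff subset_singleton_iff not_one_less_zero One_nat_def)
    then obtain y where y: "y \<in> Field r" "y \<noteq> z" by auto
    have z_only: "x = z" if "x \<in> min_elts r" for x
      using z(2)[OF that] min_eltsD[OF True] by blast
    then have "(z, y) \<in> r"
      using ex_min_below[OF r(1) y(1)] by metis
    then have "y \<in> above_min r"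
      using y z_only by (auto simp: above_min_def)
    then show ?thesis by auto
  next
    case False
    then have "z \<in> above_min r"
      using z by (auto simp: above_min_def)
    then show ?thesis by auto
  qed
  moreover have "m \<notin> above_min r"
    using m(1) by (auto simp: above_min_def)
  \<comment> \<open>Take \<open>y\<close> minimal below \<open>t\<close> and \<open>x\<close>
    minimal but not strictly below \<open>t\<close>. Both are below \<open>u\<close>, so
    \<open>x\<close>, \<open>u\<close>, \<open>y\<close>, \<open>t\<close> would form an N unless
    \<open>t \<le> u\<close>; if \<open>x = t\<close>, this is immediate.\<close>
  moreover have "(t, u) \<in> r" if t: "t \<in> Field r - above_min r" and u: "u \<in> above_min r" for t u
  proof -
    obtain y where y: "y \<in> min_elts r" "(y, t) \<in> r"
      using ex_min_below[OF r(1)] t by blast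
    obtain x where x: "x \<in> min_elts r" "(x, t) \<notin> r \<or> x = t"
      using t by (auto simp: above_min_def)
    have xu: "(x, u) \<in> r" "(y, u) \<in> r"
      using u x(1) y(1) by (auto simp: above_min_def)
    show ?thesis
    proof (cases "x = t")
      case False
      then have "(x, t) \<notin> r"
        using x by blast
      moreover from this have "(y, x) \<notin> r"
        using min_eltsD[OF x(1)] y(2) by blast
      ultimately show ?thesis
        using N_freeD[OF r(2) xu y(2)] by blast
    qed (use xu in simp)
  qed
  moreover have "above_min r \<subseteq> Field r" "m \<in> Field r"
    using m(1) by (auto simp: above_min_def min_elts_def)
  ultimately show ?thesis
    unfolding cut_def by blast
qed

text \<open>A point of \<open>U - V\<close> and a point of \<open>V - U\<close> would each lie below
  the other.\<close>

lemma cut_linear: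
  assumes "finite_poset r" "cut r U" "cut r V"
  shows "U \<subseteq> V \<or> V \<subseteq> U"
proof (rule ccontr)
  assume "\<not> ?thesis"
  then obtain u v where "u \<in> U - V" "v \<in> V - U" by blast
  moreover from this have "(u, v) \<in> r" "(v, u) \<in> r"
    using assms(2,3) unfolding cut_def by blast+
  ultimately show False
    using finite_posetD(4)[OF assms(1)] by blast
qed

text \<open>Points outside \<open>U\<close> lie below all of \<open>U\<close>, hence below
  \<open>V\<close>, so only the points of \<open>U - V\<close> remain to be compared. A cut of the
  upper factor is thus a smaller cut of the whole poset.\<close>

lemma cut_Restr:
  assumes r: "finite_poset r" and U: "cut r U" and V: "V \<subset> U"
  shows "cut (Restr r U) V \<longleftrightarrow> cut r V"
proof -
  have "Field (Restr r U) = U"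
    using Field_Restr[OF r] U by (auto simp: cut_def)
  moreover have VF: "V \<subset> Field r"
    using U V by (auto simp: cut_def)
  moreover have "(U - V) \<times> V \<subseteq> Restr r U \<longleftrightarrow> (Field r - V) \<times> V \<subseteq> r"
  proof -
    have "(Field r - U) \<times> V \<subseteq> r"
      using U V by (auto simp: cut_def)
    moreover have "(Field r - V) \<times> V = (Field r - U) \<times> V \<union> (U - V) \<times> V"
      using U V by (auto simp: cut_def)
    moreover have "(U - V) \<times> V \<subseteq> U \<times> U"
      using V by blast
    ultimately show ?thesis by simp
  qed
  ultimately show ?thesis
    using V unfolding cut_def by simp
qed

lemma cut_eq_down_prod:
  assumes r: "finite_poset r" and "cut r U"
  shows "r = Restr r (Field r - U) \<down> Restr r U"
proof -
  have "Field (Restr r (Field r - U)) = Field r - U" "Field (Restr r U) = U"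
    using Field_Restr[OF r] assms(2) by (auto simp: cut_def)
  moreover have "(x, y) \<notin> r" if "x \<in> U" "y \<in> Field r - U" for x y
  proof
    assume "(x, y) \<in> r"
    moreover have "(y, x) \<in> r"
      using assms(2) that unfolding cut_def by blast
    ultimately show False
      using finite_posetD(4)[OF r] that by blast
  qed
  then have "r = Restr r (Field r - U) \<union> Restr r U \<union> r \<inter> (Field r - U) \<times> U"
  proof -
    have "r \<subseteq> Field r \<times> Field r"
      by (auto intro: FieldI1 FieldI2)
    then show ?thesis
      using \<open>\<And>y x. x \<in> U \<Longrightarrow> y \<in> Field r - U \<Longrightarrow> (x, y) \<notin> r\<close> by blast
  qed
  moreover have "r \<inter> (Field r - U) \<times> U = (Field r - U) \<times> U"
    using assms(2) unfolding cut_def by blast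
  ultimately show ?thesis
    unfolding down_prod_def by simp
qed

section \<open>The product \<open>\<down>\<close> and the decomposition of WN posets\<close>

lemma Field_down_prod: "Field (r \<down> s) = Field r \<union> Field s"
  by (auto simp: down_prod_def Field_def)

lemma down_prod_lower_iff:
  assumes "Field r \<inter> Field s = {}" "y \<in> Field r"
  shows "(x, y) \<in> r \<down> s \<longleftrightarrow> (x, y) \<in> r"
  using assms by (auto simp: down_prod_def dest: FieldI2)

lemma down_prod_upper_iff:
  assumes "Field r \<inter> Field s = {}" "x \<in> Field s"
  shows "(x, y) \<in> r \<down> s \<longleftrightarrow> (x, y) \<in> s"
  using assms by (auto simp: down_prod_def dest: FieldI1)

lemma down_prod_between: "x \<in> Field r \<Longrightarrow> y \<in> Field s \<Longrightarrow> (x, y) \<in> r \<down> s"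
  by (auto simp: down_prod_def)

lemma down_prod_Restr:
  assumes "Field r \<inter> Field s = {}"
  shows "Restr (r \<down> s) (Field r) = r" "Restr (r \<down> s) (Field s) = s"
proof -
  have "r \<subseteq> r \<down> s" "s \<subseteq> r \<down> s"
    by (auto simp: down_prod_def)
  then have "r \<subseteq> Restr (r \<down> s) (Field r)" "s \<subseteq> Restr (r \<down> s) (Field s)"
    by (auto intro: FieldI1 FieldI2)
  moreover have "Restr (r \<down> s) (Field r) \<subseteq> r" "Restr (r \<down> s) (Field s) \<subseteq> s"
    using down_prod_lower_iff[OF assms] down_prod_upper_iff[OF assms] by auto
  ultimately show "Restr (r \<down> s) (Field r) = r" "Restr (r \<down> s) (Field s) = s"
    by (simp_all add: subset_antisym)
qed

lemma cut_down_prod: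
  assumes "Field r \<inter> Field s = {}" "r \<noteq> {}" "s \<noteq> {}"
  shows "cut (r \<down> s) (Field s)"
  using assms Field_nonempty[of r] Field_nonempty[of s] unfolding cut_def Field_down_prod
  by (auto simp: down_prod_def)

lemma finite_poset_down_prod:
  assumes r: "finite_poset r" and s: "finite_poset s" and disj: "Field r \<inter> Field s = {}"
  shows "finite_poset (r \<down> s)"
proof (rule finite_posetI)
  note iffs = down_prod_lower_iff[OF disj] down_prod_upper_iff[OF disj]
  have F: "x \<in> Field r \<or> x \<in> Field s" "y \<in> Field r \<or> y \<in> Field s" if "(x, y) \<in> r \<down> s" for x y
    using FieldI1[OF that] FieldI2[OF that] by (auto simp: Field_down_prod)
  show "finite (Field (r \<down> s))"
    using finite_posetD(1) r s by (auto simp: Field_down_prod)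
  show "(x, x) \<in> r \<down> s" if "x \<in> Field (r \<down> s)" for x
    using that finite_posetD(2)[OF r] finite_posetD(2)[OF s] iffs[of x x] by (auto simp: Field_down_prod)
  show "(x, z) \<in> r \<down> s" if xy: "(x, y) \<in> r \<down> s" and yz: "(y, z) \<in> r \<down> s" for x y z
  proof (cases "x \<in> Field r")
    case True
    show ?thesis
    proof (cases "z \<in> Field r")
      case z: True
      have yz': "(y, z) \<in> r"
        using yz iffs(1)[OF z] by simp
      have "(x, y) \<in> r"
        using xy iffs(1)[OF FieldI1[OF yz']] by simp
      then show ?thesis
        using finite_posetD(3)[OF r _ yz'] iffs(1)[OF z] by simp
    next
      case False
      then have "z \<in> Field s"
        using F(2)[OF yz] by simp
      with True show ?thesis
        by (rule down_prod_between)
    qed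
  next
    case False
    then have x: "x \<in> Field s"
      using F(1)[OF xy] by simp
    have xy': "(x, y) \<in> s"
      using xy iffs(2)[OF x] by simp
    have "(y, z) \<in> s"
      using yz iffs(2)[OF FieldI2[OF xy']] by simp
    then show ?thesis
      using finite_posetD(3)[OF s xy'] iffs(2)[OF x] by simp
  qed
  show "x = y" if xy: "(x, y) \<in> r \<down> s" and yx: "(y, x) \<in> r \<down> s" for x y
  proof (cases "x \<in> Field r")
    case True
    have yx': "(y, x) \<in> r"
      using yx iffs(1)[OF True] by simp
    have "(x, y) \<in> r"
      using xy iffs(1)[OF FieldI1[OF yx']] by simp
    then show ?thesis
      using finite_posetD(4)[OF r] yx' by simp
  next
    case False
    then have x: "x \<in> Field s"
      using F(1)[OF xy] by simp
    have xy': "(x, y) \<in> s"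
      using xy iffs(2)[OF x] by simp
    have "(y, x) \<in> s"
      using yx iffs(2)[OF FieldI2[OF xy']] by simp
    then show ?thesis
      using finite_posetD(4)[OF s xy'] by simp
  qed
qed

text \<open>Incomparable points of \<open>r \<down> s\<close> lie in the same factor, and the
  incomparability graph of N is the path \<open>y - x - t - z\<close>. So an N in the product would
  lie in one factor.\<close>

lemma WN_down_prod:
  assumes r: "WN r" and s: "WN s" and disj: "Field r \<inter> Field s = {}"
  shows "WN (r \<down> s)"
  unfolding WN_iff
proof
  show "finite_poset (r \<down> s)"
    using assms finite_poset_down_prod by (auto simp: WN_iff)
  have N: "N_free r" "N_free s"
    using r s by (auto simp: WN_iff)
  show "N_free (r \<down> s)"
    unfolding N_free_def
  proof (intro allI impI)
    fix x y z t assume xz: "(x, z) \<in> r \<down> s" and yz: "(y, z) \<in> r \<down> s" and yt: "(y, t) \<in> r \<down> s"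
    have F: "x \<in> Field r \<union> Field s" "y \<in> Field r \<union> Field s"
        "z \<in> Field r \<union> Field s" "t \<in> Field r \<union> Field s"
      using xz yz yt unfolding Field_down_prod[symmetric] by (auto intro: FieldI1 FieldI2)
    note r_iff = down_prod_lower_iff[OF disj] and s_iff = down_prod_upper_iff[OF disj]
    note between = down_prod_between[of _ r _ s]
    show "(x, t) \<in> r \<down> s \<or> (y, x) \<in> r \<down> s \<or> (t, z) \<in> r \<down> s"
    proof (rule ccontr)
      assume "\<not> ?thesis"
      then have neg: "(x, t) \<notin> r \<down> s" "(y, x) \<notin> r \<down> s" "(t, z) \<notin> r \<down> s" by auto
      show False
      proof (cases "x \<in> Field r")
        case x: True
        then have t: "t \<in> Field r"
          using between[of x t] F(4) neg(1) by blast
        then have z: "z \<in> Field r"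
          using between[of t z] F(3) neg(3) by blast
        have "(x, z) \<in> r" "(y, z) \<in> r" "(y, t) \<in> r" "(x, t) \<notin> r" "(y, x) \<notin> r" "(t, z) \<notin> r"
          using xz yz yt neg r_iff[OF x] r_iff[OF t] r_iff[OF z] by simp_all
        then show False
          using N_freeD[OF N(1)] by metis
      next
        case False
        then have x: "x \<in> Field s"
          using F(1) by blast
        then have y: "y \<in> Field s"
          using between[of y x] F(2) neg(2) by blast
        have "(y, t) \<in> s"
          using yt s_iff[OF y] by simp
        then have t: "t \<in> Field s"
          by (rule FieldI2)
        have "(x, z) \<in> s" "(y, z) \<in> s" "(x, t) \<notin> s" "(y, x) \<notin> s" "(t, z) \<notin> s"
          using xz yz neg s_iff[OF x] s_iff[OF y] s_iff[OF t] by simp_all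
        then show False
          using N_freeD[OF N(2)] \<open>(y, t) \<in> s\<close> by metis
      qed
    qed
  qed
qed

lemma down_decomposition_iff:
  "down_decomposition r r1 r2 \<longleftrightarrow> decomposition (\<lambda>r. WN r \<and> r \<noteq> {}) (\<down>) r r1 r2"
  by (auto simp: down_decomposition_def decomposition_def)

interpretation WN: poset_class "\<lambda>r. WN r \<and> r \<noteq> {}" "(\<down>) :: 'a rel \<Rightarrow> _"
proof
  let ?D = "decomposition (\<lambda>r. WN r \<and> r \<noteq> {}) (\<down>)"
  show "finite_poset r" if "WN r \<and> r \<noteq> {}" for r :: "'a rel"
    using that by (simp add: WN_iff)
  show "r \<noteq> {}" if "WN r \<and> r \<noteq> {}" for r :: "'a rel"
    using that by simp
  show "WN {(x, x)} \<and> {(x, x)} \<noteq> {}" for x :: 'a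
    by (auto simp: WN_iff finite_poset_singleton N_free_def)
  show "WN r \<and> r \<noteq> {} \<longleftrightarrow> (\<forall>c\<in>components r. WN c \<and> c \<noteq> {})"
    if "finite_poset r" "\<not> connected_poset r" for r :: "'a rel"
  proof -
    have "r \<noteq> {}"
      using that(2) by (auto simp: connected_poset_def)
    then show ?thesis
      using WN_iff_components[OF that(1)] disjoint_connected_components[OF that(1)]
      by (auto simp: disjoint_connected_def)
  qed
  show "(WN r \<and> r \<noteq> {}) \<and> connected_poset r \<and> Field r = Field r1 \<union> Field r2"
    if "?D r r1 r2" for r r1 r2 :: "'a rel"
  proof -
    have r: "WN r1" "r1 \<noteq> {}" "WN r2" "r2 \<noteq> {}" "Field r1 \<inter> Field r2 = {}" "r = r1 \<down> r2"
      using that by (auto simp: decomposition_def)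
    have "WN r"
      using WN_down_prod r by blast
    moreover have "connected_poset r"
      using cut_connected[of r "Field r2"] cut_down_prod r \<open>WN r\<close> by (auto simp: WN_iff)
    ultimately show ?thesis
      using r(2,6) Field_down_prod[of r1 r2] by (auto simp: down_prod_def)
  qed
  show "\<exists>r1 r2. ?D r r1 r2"
    if r: "WN r \<and> r \<noteq> {}" "connected_poset r" "card (Field r) > 1" for r :: "'a rel"
  proof -
    have poset: "finite_poset r"
      using r(1) by (simp add: WN_iff)
    have "cut r (above_min r)"
      using cut_above_min r by blast
    from ex_has_least_nat[where P = "cut r" and m = card, OF this]
    obtain U where U: "cut r U" and least: "\<forall>V. cut r V \<longrightarrow> card U \<le> card V"
      by blast
    have UF: "U \<subset> Field r" "U \<noteq> {}"
      using U by (auto simp: cut_def)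
    have F: "Field (Restr r (Field r - U)) = Field r - U" "Field (Restr r U) = U"
      using Field_Restr[OF poset] UF by auto
    have finU: "finite U"
      using UF finite_posetD(1)[OF poset] finite_subset by blast
    \<comment> \<open>Otherwise \<open>above_min\<close> of the restriction would be a cut of it,
      hence a cut of \<open>r\<close> with fewer points than \<open>U\<close>.\<close>
    have "\<not> connected_poset (Restr r U) \<or> card U = 1"
    proof (rule ccontr)
      assume "\<not> ?thesis"
      moreover from this have "card (Field (Restr r U)) > 1"
        unfolding F using UF(2) finU card_gt_0_iff[of U] by linarith
      ultimately have "cut (Restr r U) (above_min (Restr r U))"
        using cut_above_min WN_Restr r(1) by blast
      moreover from this have sub: "above_min (Restr r U) \<subset> U"
        unfolding cut_def F by blast
      ultimately have "cut r (above_min (Restr r U))"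
        using cut_Restr[OF poset U] by blast
      then have "card U \<le> card (above_min (Restr r U))"
        using least by blast
      then show False
        using psubset_card_mono[OF finU sub] by simp
    qed
    moreover have "Restr r (Field r - U) \<noteq> {}" "Restr r U \<noteq> {}"
      using F UF by auto
    ultimately have "?D r (Restr r (Field r - U)) (Restr r U)"
      using WN_Restr r(1) cut_eq_down_prod[OF poset U] F by (auto simp: decomposition_def)
    then show ?thesis by blast
  qed
  \<comment> \<open>A strictly smaller upper factor would give a cut of \<open>r2\<close>. Then
    \<open>r2\<close> is connected, hence a singleton, which has no nonempty proper subset.\<close>
  have aux: "\<not> Field s2 \<subset> Field r2" if D: "?D r r1 r2" "?D r s1 s2" for r r1 r2 s1 s2 :: "'a rel"
  proof
    assume sub: "Field s2 \<subset> Field r2"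
    have r: "WN r1" "r1 \<noteq> {}" "WN r2" "r2 \<noteq> {}" "Field r1 \<inter> Field r2 = {}" "r = r1 \<down> r2"
        "\<not> connected_poset r2 \<or> card (Field r2) = 1"
      using D(1) by (auto simp: decomposition_def)
    have s: "s1 \<noteq> {}" "s2 \<noteq> {}" "Field s1 \<inter> Field s2 = {}" "r = s1 \<down> s2"
      using D(2) by (auto simp: decomposition_def)
    have poset: "finite_poset r" "finite_poset r2"
      using WN_down_prod r by (auto simp: WN_iff)
    have "cut r (Field s2)" "cut r (Field r2)"
      using cut_down_prod r s by metis+
    then have "cut r2 (Field s2)"
      using cut_Restr[OF poset(1) _ sub] r down_prod_Restr(2) by metis
    then have "connected_poset r2"
      using cut_connected poset(2) by blast
    then have "card (Field r2) = 1"
      using r(7) by blast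
    moreover have "card (Field s2) < card (Field r2)"
      using psubset_card_mono[OF _ sub] finite_posetD(1)[OF poset(2)] by blast
    moreover have "card (Field s2) \<noteq> 0"
      using Field_nonempty[OF s(2)] finite_subset[of "Field s2"] sub finite_posetD(1)[OF poset(2)]
      by auto
    ultimately show False
      by simp
  qed
  show "s1 = r1 \<and> s2 = r2" if D: "?D r r1 r2" "?D r s1 s2" for r r1 r2 s1 s2 :: "'a rel"
  proof -
    have r: "WN r1" "r1 \<noteq> {}" "WN r2" "r2 \<noteq> {}" "Field r1 \<inter> Field r2 = {}" "r = r1 \<down> r2"
      using D(1) by (auto simp: decomposition_def)
    have s: "s1 \<noteq> {}" "s2 \<noteq> {}" "Field s1 \<inter> Field s2 = {}" "r = s1 \<down> s2"
      using D(2) by (auto simp: decomposition_def)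
    have "finite_poset r"
      using WN_down_prod r by (auto simp: WN_iff)
    moreover have "cut r (Field s2)" "cut r (Field r2)"
      using cut_down_prod r s by metis+
    \<comment> \<open>Cuts form a chain, and \<open>aux\<close> in both directions excludes strict
      inclusion.\<close>
    ultimately have F2: "Field s2 = Field r2"
      using cut_linear aux[OF D] aux[OF D(2,1)] by blast
    have "Field r = Field r1 \<union> Field r2" "Field r = Field s1 \<union> Field s2"
      using r(6) s(4) Field_down_prod by metis+
    then have F1: "Field s1 = Field r1"
      using F2 r(5) s(3) by blast
    show ?thesis
      using down_prod_Restr[OF r(5)] down_prod_Restr[OF s(3)] F1 F2 r(6) s(4) by metis
  qed
qed


section \<open>\<open>\<triangledown>\<close>-compatible posets\<close>

lemma Field_tri_prod: "Field (r \<triangledown> s) = Field r \<union> Field s"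
proof
  show "Field (r \<triangledown> s) \<subseteq> Field r \<union> Field s"
    by (auto simp: tri_prod_def Field_def min_elts_def)
  show "Field r \<union> Field s \<subseteq> Field (r \<triangledown> s)"
    by (auto simp: tri_prod_def Field_def)
qed

lemma tri_prod_cases:
  assumes "(x, y) \<in> r \<triangledown> s"
  obtains "(x, y) \<in> r" | "(x, y) \<in> s" | "x \<in> min_elts s" "y \<in> Field r"
  using assms by (auto simp: tri_prod_def)

text \<open>In \<open>r \<triangledown> s\<close> the right factor is the lower one, opposite to
  \<open>r \<down> s\<close>. No point of \<open>r\<close> lies below a point of
  \<open>s\<close>.\<close>

lemma tri_prod_lower_iff:
  assumes "Field r \<inter> Field s = {}" "y \<in> Field s"
  shows "(x, y) \<in> r \<triangledown> s \<longleftrightarrow> (x, y) \<in> s"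
  using assms by (auto simp: tri_prod_def dest: FieldI2)

lemma tri_prod_upper_iff:
  assumes "Field r \<inter> Field s = {}" "x \<in> Field r"
  shows "(x, y) \<in> r \<triangledown> s \<longleftrightarrow> (x, y) \<in> r"
  using assms by (auto simp: tri_prod_def min_elts_def dest: FieldI1)

lemma tri_prod_between: "x \<in> min_elts s \<Longrightarrow> y \<in> Field r \<Longrightarrow> (x, y) \<in> r \<triangledown> s"
  by (auto simp: tri_prod_def)

lemma tri_prod_Restr:
  assumes "Field r \<inter> Field s = {}"
  shows "Restr (r \<triangledown> s) (Field r) = r" "Restr (r \<triangledown> s) (Field s) = s"
proof -
  have "r \<subseteq> r \<triangledown> s" "s \<subseteq> r \<triangledown> s"
    by (auto simp: tri_prod_def)
  then have "r \<subseteq> Restr (r \<triangledown> s) (Field r)" "s \<subseteq> Restr (r \<triangledown> s) (Field s)"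
    by (auto intro: FieldI1 FieldI2)
  moreover have "Restr (r \<triangledown> s) (Field r) \<subseteq> r" "Restr (r \<triangledown> s) (Field s) \<subseteq> s"
    using tri_prod_lower_iff[OF assms] tri_prod_upper_iff[OF assms] by auto
  ultimately show "Restr (r \<triangledown> s) (Field r) = r" "Restr (r \<triangledown> s) (Field s) = s"
    by (simp_all add: subset_antisym)
qed

lemma finite_poset_tri_prod:
  assumes r: "finite_poset r" and s: "finite_poset s" "s \<noteq> {}" and disj: "Field r \<inter> Field s = {}"
  shows "finite_poset (r \<triangledown> s)"
proof (rule finite_posetI)
  note F = Field_tri_prod[of r s]
  note lower = tri_prod_lower_iff[OF disj] and upper = tri_prod_upper_iff[OF disj]
  show "finite (Field (r \<triangledown> s))"
    using finite_posetD(1) r s by (auto simp: F)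
  show "(x, x) \<in> r \<triangledown> s" if "x \<in> Field (r \<triangledown> s)" for x
    using that finite_posetD(2)[OF r] finite_posetD(2)[OF s(1)] lower[of x x] upper[of x x]
    by (auto simp: F)
  show "(x, z) \<in> r \<triangledown> s" if xy: "(x, y) \<in> r \<triangledown> s" and yz: "(y, z) \<in> r \<triangledown> s" for x y z
    using yz
  proof (cases rule: tri_prod_cases)
    case 1
    from xy show ?thesis
    proof (cases rule: tri_prod_cases)
      case 2
      then show ?thesis
        using 1 disj by (auto dest: FieldI1 FieldI2)
    qed (use 1 finite_posetD(3)[OF r _ 1] in \<open>auto simp: tri_prod_def intro: FieldI2\<close>)
  next
    case 2
    then have "(x, y) \<in> s"
      using xy lower[OF FieldI1[OF 2]] by simp
    then show ?thesis
      using finite_posetD(3)[OF s(1) _ 2] by (auto simp: tri_prod_def)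
  next
    \<comment> \<open>Here \<open>y\<close> is minimal in \<open>s\<close>, and only points of
      \<open>s\<close> lie below points of \<open>s\<close>, so \<open>x = y\<close>.\<close>
    case 3
    then have "y \<in> Field s"
      by (auto simp: min_elts_def)
    then have "(x, y) \<in> s"
      using xy lower by simp
    then have "x = y"
      by (rule min_eltsD[OF 3(1)])
    then show ?thesis
      using yz by simp
  qed
  show "x = y" if xy: "(x, y) \<in> r \<triangledown> s" and yx: "(y, x) \<in> r \<triangledown> s" for x y
  proof (cases "x \<in> Field r")
    case True
    have xy': "(x, y) \<in> r"
      using xy upper[OF True] by simp
    have "(y, x) \<in> r"
      using yx upper[OF FieldI2[OF xy']] by simp
    then show ?thesis
      using finite_posetD(4)[OF r xy'] by simp
  next
    case False
    then have x: "x \<in> Field s"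
      using FieldI1[OF xy] by (simp add: F)
    have yx': "(y, x) \<in> s"
      using yx lower[OF x] by simp
    have "(x, y) \<in> s"
      using xy lower[OF FieldI1[OF yx']] by simp
    then show ?thesis
      using finite_posetD(4)[OF s(1) _ yx'] by simp
  qed
qed

text \<open>\<open>s\<close> has a minimal element, and it lies below every point of
  \<open>r\<close>, so no point of \<open>r\<close> is minimal.\<close>

lemma min_elts_tri_prod:
  assumes s: "finite_poset s" "s \<noteq> {}" and disj: "Field r \<inter> Field s = {}"
  shows "min_elts (r \<triangledown> s) = min_elts s"
proof
  note F = Field_tri_prod[of r s]
  show "min_elts s \<subseteq> min_elts (r \<triangledown> s)"
    using tri_prod_lower_iff[OF disj] unfolding min_elts_def F by auto
  show "min_elts (r \<triangledown> s) \<subseteq> min_elts s"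
  proof
    fix x assume x: "x \<in> min_elts (r \<triangledown> s)"
    obtain y where "y \<in> Field s"
      using Field_nonempty[OF s(2)] by blast
    from ex_min_below[OF s(1) this] obtain m where m: "m \<in> min_elts s"
      by blast
    have "x \<in> Field s"
    proof (rule ccontr)
      assume "x \<notin> Field s"
      then have "x \<in> Field r"
        using x min_elts_subset[of "r \<triangledown> s"] F by blast
      then have "m = x"
        using min_eltsD[OF x tri_prod_between[OF m]] by simp
      then show False
        using m \<open>x \<notin> Field s\<close> by (auto simp: min_elts_def)
    qed
    then show "x \<in> min_elts s"
      using x tri_prod_lower_iff[OF disj] by (auto simp: min_elts_def)
  qed
qed

text \<open>Every point is above some minimal element, and all of these are below \<open>y\<close>,
  so everything is linked to \<open>y\<close>.\<close>

lemma connected_if_above_min: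
  assumes r: "finite_poset r" and "y \<in> Field r" "\<And>x. x \<in> min_elts r \<Longrightarrow> (x, y) \<in> r"
  shows "connected_poset r"
  unfolding connected_iff_saturated[OF r]
proof (intro allI impI)
  fix U assume U: "saturated r U"
  have sat: "u \<in> U \<longleftrightarrow> v \<in> U" if "(u, v) \<in> r" for u v
    using U that unfolding saturated_def by blast
  have "w \<in> U \<longleftrightarrow> y \<in> U" if w: "w \<in> Field r" for w
  proof -
    obtain m where "m \<in> min_elts r" "(m, w) \<in> r"
      by (rule ex_min_below[OF r w])
    then show ?thesis
      using sat[of m w] sat[of m y] assms(3) by simp
  qed
  moreover have "U \<subseteq> Field r"
    using U by (simp add: saturated_def)
  ultimately show "U = {} \<or> U = Field r"
    by blast
qed

text \<open>A point of \<open>s\<close> strictly above all minimal elements of \<open>s\<close>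
  would make \<open>s\<close> connected, hence a singleton; but its only point is minimal and not
  strictly above itself.\<close>

lemma above_min_tri_prod:
  assumes r: "finite_poset r" and s: "finite_poset s" "s \<noteq> {}" and disj: "Field r \<inter> Field s = {}"
    and irreducible: "\<not> connected_poset s \<or> card (Field s) = 1"
  shows "above_min (r \<triangledown> s) = Field r"
proof
  note F = Field_tri_prod[of r s] and min = min_elts_tri_prod[OF s disj]
  show "Field r \<subseteq> above_min (r \<triangledown> s)"
    unfolding above_min_def F min using tri_prod_between[of _ s _ r] disj by (auto simp: min_elts_def)
  show "above_min (r \<triangledown> s) \<subseteq> Field r"
  proof (rule ccontr)
    assume "\<not> ?thesis"
    then obtain y where "y \<in> above_min (r \<triangledown> s)" "y \<notin> Field r" by auto
    then have y: "y \<in> Field s" "\<And>x. x \<in> min_elts s \<Longrightarrow> (x, y) \<in> r \<triangledown> s \<and> x \<noteq> y"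
      unfolding above_min_def F min by auto
    then have ys: "(x, y) \<in> s" "x \<noteq> y" if "x \<in> min_elts s" for x
      using that tri_prod_lower_iff[OF disj y(1)] by auto
    then have "connected_poset s"
      using connected_if_above_min[OF s(1) y(1)] by blast
    then have "card (Field s) = 1"
      using irreducible by simp
    then obtain z where "s = {(z, z)}"
      by (rule finite_poset_card_1[OF s(1)])
    then show False
      using ys(2)[of z] y(1) by (auto simp: min_elts_def)
  qed
qed

section \<open>Decomposition of \<triangledown>-compatible posets\<close>

lemma tri_compatible_poset:
  assumes "tri_compatible r"
  shows "finite_poset r \<and> r \<noteq> {}"
  using assms by cases (auto simp: finite_poset_singleton)

lemma b_part_nonempty_iff:
  "finite_poset r \<Longrightarrow> b_part r \<noteq> {} \<longleftrightarrow> above_min r \<noteq> {}"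
  using finite_posetD(2)[of r] by (auto simp: b_part_def above_min_def)

lemma above_min_subset: "above_min r \<subseteq> Field r"
  by (auto simp: above_min_def)

lemma Field_b_part: "finite_poset r \<Longrightarrow> Field (b_part r) = above_min r"
  unfolding b_part_def by (rule Field_Restr) (auto simp: above_min_def)

lemma Field_r_part: "finite_poset r \<Longrightarrow> Field (r_part r) = Field r - above_min r"
  unfolding r_part_def by (rule Field_Restr) auto

text \<open>\<open>b_part r\<close> and \<open>r_part r\<close> are determined by \<open>r\<close>
  alone, so uniqueness of the decomposition is immediate from this.\<close>

lemma tri_decomposition_parts:
  assumes "decomposition tri_compatible (\<triangledown>) r r1 r2"
  shows "finite_poset r" "connected_poset r" "Field r = Field r1 \<union> Field r2"
    "b_part r = r1" "r_part r = r2"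
proof -
  have d: "tri_compatible r1" "tri_compatible r2" "Field r1 \<inter> Field r2 = {}" "r = r1 \<triangledown> r2"
      "\<not> connected_poset r2 \<or> card (Field r2) = 1"
    using assms by (auto simp: decomposition_def)
  then have p: "finite_poset r1" "r1 \<noteq> {}" "finite_poset r2" "r2 \<noteq> {}"
    using tri_compatible_poset by auto
  show poset: "finite_poset r"
    using finite_poset_tri_prod[OF p(1,3,4)] d by simp
  show F: "Field r = Field r1 \<union> Field r2"
    using Field_tri_prod d(4) by simp
  have a: "above_min r = Field r1"
    using above_min_tri_prod[OF p(1,3,4)] d by simp
  show "connected_poset r"
    using connected_if_above_min[OF poset] Field_nonempty[OF p(2)] unfolding a[symmetric]
    by (auto simp: above_min_def)
  have "Field r - Field r1 = Field r2"
    using F d(3) by auto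
  then show "b_part r = r1" "r_part r = r2"
    using tri_prod_Restr[OF d(3)] unfolding b_part_def r_part_def a d(4)[symmetric] by simp_all
qed

lemma irreducible_r_part:
  assumes "tri_compatible (r_part r)" and r: "finite_poset r" "r = b_part r \<triangledown> r_part r"
  shows "\<not> connected_poset (r_part r) \<or> card (Field (r_part r)) = 1"
proof (rule ccontr)
  assume *: "\<not> ?thesis"
  let ?s = "r_part r"
  have s: "finite_poset ?s" "?s \<noteq> {}"
    using tri_compatible_poset[OF assms(1)] by auto
  \<comment> \<open>Among the rules of \<open>tri_compatible\<close>, only \<open>connected\<close>
    applies to a connected poset with more than one element.\<close>
  have "b_part ?s \<noteq> {}"
    using assms(1) * by cases auto
  then obtain y where y: "y \<in> above_min ?s"
    using b_part_nonempty_iff[OF s(1)] by auto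
  have disj: "Field (b_part r) \<inter> Field ?s = {}"
    by (auto simp: Field_b_part[OF r(1)] Field_r_part[OF r(1)])
  have "min_elts r = min_elts ?s"
    using min_elts_tri_prod[OF s disj] r(2) by simp
  moreover have "?s \<subseteq> r"
    by (auto simp: r_part_def)
  moreover have "Field ?s \<subseteq> Field r"
    by (auto simp: Field_r_part[OF r(1)])
  ultimately have "y \<in> above_min r"
    using y unfolding above_min_def by auto
  then show False
    using y above_min_subset[of ?s] by (auto simp: Field_r_part[OF r(1)])
qed

interpretation tri: poset_class tri_compatible "(\<triangledown>) :: 'a rel \<Rightarrow> _"
proof
  let ?D = "decomposition tri_compatible (\<triangledown>)"
  show "finite_poset r" "r \<noteq> {}" if "tri_compatible r" for r :: "'a rel"
    using tri_compatible_poset[OF that] by auto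
  show "tri_compatible {(x, x)}" for x :: 'a
    by (rule tri_compatible.single)
  show "tri_compatible r \<longleftrightarrow> (\<forall>c\<in>components r. tri_compatible c)"
    if "finite_poset r" "\<not> connected_poset r" for r :: "'a rel"
  proof
    assume "tri_compatible r"
    then show "\<forall>c\<in>components r. tri_compatible c"
    proof cases
      case (single x)
      then have "connected_poset r"
        by (simp add: connected_singleton)
      then show ?thesis
        using that(2) by blast
    next
      case connected
      then show ?thesis
        using that(2) by blast
    qed blast
  next
    assume "\<forall>c\<in>components r. tri_compatible c"
    then show "tri_compatible r"
      by (rule tri_compatible.disconnected[OF that(1) card_Field_disconnected[OF that] that(2)])
  qed
  show "tri_compatible r \<and> connected_poset r \<and> Field r = Field r1 \<union> Field r2"
    if D: "?D r r1 r2" for r r1 r2 :: "'a rel"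
  proof -
    note parts = tri_decomposition_parts[OF D]
    have d: "tri_compatible r1" "tri_compatible r2" "Field r1 \<inter> Field r2 = {}" "r = r1 \<triangledown> r2"
      using D by (auto simp: decomposition_def)
    then have p: "finite_poset r1" "r1 \<noteq> {}" "finite_poset r2" "r2 \<noteq> {}"
      using tri_compatible_poset by auto
    have "card (Field r) = card (Field r1) + card (Field r2)"
      unfolding parts(3) using p d(3) finite_posetD(1) by (intro card_Un_disjoint) auto
    moreover have "card (Field r1) > 0" "card (Field r2) > 0"
      using p finite_posetD(1) Field_nonempty by (auto simp: card_gt_0_iff)
    ultimately have "card (Field r) \<ge> 2"
      by simp
    then have "tri_compatible r"
      by (rule tri_compatible.connected[OF parts(1) _ parts(2)])
        (simp_all only: parts(4,5) p(2) d(1,2) d(4)[symmetric] simp_thms)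
    then show ?thesis
      using parts by simp
  qed
  show "\<exists>r1 r2. ?D r r1 r2"
    if r: "tri_compatible r" "connected_poset r" "card (Field r) > 1" for r :: "'a rel"
    using r(1)
  proof cases
    case connected
    have "Field (b_part r) \<inter> Field (r_part r) = {}"
      unfolding Field_b_part[OF connected(1)] Field_r_part[OF connected(1)] by blast
    then have "?D r (b_part r) (r_part r)"
      unfolding decomposition_def
      by (intro conjI connected irreducible_r_part)
    then show ?thesis by blast
  qed (use r in auto)
  show "s1 = r1 \<and> s2 = r2" if "?D r r1 r2" "?D r s1 s2" for r r1 r2 s1 s2 :: "'a rel"
    using tri_decomposition_parts(4,5)[OF that(1)] tri_decomposition_parts(4,5)[OF that(2)] by simp
qed


section \<open>The map \<open>\<theta>\<close>\<close>

interpretation WN_tri: poset_class_pair "\<lambda>r. WN r \<and> r \<noteq> {}" "(\<down>)" tri_compatible "(\<triangledown>) :: 'a rel \<Rightarrow> _" ..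

text \<open>A poset with a decomposition is a connected WN poset with at least two points, so the
  third clauses agree; the empty poset counts as connected, so the second ones agree too.\<close>

lemma theta_recursion_iff:
  "theta_recursion \<theta> \<longleftrightarrow> recursion (\<lambda>r. WN r \<and> r \<noteq> {}) (\<down>) (\<triangledown>) \<theta>"
proof -
  have "WN r \<and> connected_poset r \<and> card (Field r) > 1 \<and> down_decomposition r r1 r2 \<longleftrightarrow>
      decomposition (\<lambda>r. WN r \<and> r \<noteq> {}) (\<down>) r r1 r2" (is "_ \<longleftrightarrow> ?D") for r r1 r2 :: "'a rel"
  proof -
    have "WN r \<and> connected_poset r \<and> card (Field r) > 1" if D: ?D
    proof -
      have "card (Field r1) > 0" "card (Field r2) > 0"
        using D WN.card_pos[of r1] WN.card_pos[of r2] unfolding decomposition_def by blast+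
      then show ?thesis
        using WN.composite[OF D] WN.card_decomposition(1)[OF D] by simp
    qed
    then show ?thesis
      unfolding down_decomposition_iff by blast
  qed
  moreover have "WN r \<and> \<not> connected_poset r \<longleftrightarrow> (WN r \<and> r \<noteq> {}) \<and> \<not> connected_poset r"
    for r :: "'a rel"
    by (auto simp: connected_poset_def)
  ultimately show ?thesis
    unfolding theta_recursion_def recursion_def by simp
qed

lemma theta_exists: "\<exists>\<theta> :: 'a rel \<Rightarrow> 'a rel. theta_recursion \<theta>"
  unfolding theta_recursion_iff using WN.recursion_transfer by blast

lemma theta_image:
  assumes "theta_recursion \<theta>" "WN r" "r \<noteq> {}"
  shows "tri_compatible (\<theta> r)" "Field (\<theta> r) = Field r"
  using WN_tri.recursion_image[of \<theta> r] assms by (auto simp: theta_recursion_iff)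

lemma WN_posets_on_iff:
  "finite A \<Longrightarrow> A \<noteq> {} \<Longrightarrow> WN_posets_on A = {r. (WN r \<and> r \<noteq> {}) \<and> Field r = A}"
  unfolding WN_posets_on_def by (auto simp: partial_order_on_iff_finite_poset WN_iff)

lemma tri_compatible_posets_on_iff:
  "finite A \<Longrightarrow> tri_compatible_posets_on A = {r. tri_compatible r \<and> Field r = A}"
  unfolding tri_compatible_posets_on_def
  by (auto simp: partial_order_on_iff_finite_poset dest: tri_compatible_poset)

lemma theta_bij_betw:
  assumes "theta_recursion \<theta>" "finite A" "A \<noteq> {}"
  shows "bij_betw \<theta> (WN_posets_on A) (tri_compatible_posets_on A)"
  unfolding WN_posets_on_iff[OF assms(2,3)] tri_compatible_posets_on_iff[OF assms(2)]
  using WN_tri.recursion_bij_betw assms(1) by (simp add: theta_recursion_iff)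

text \<open>Relabelling commutes with components and with both products, hence with each clause of
  the recursion. The label types may differ, so each side has its own solution of the
  recursion.\<close>

lemma theta_natural:
  fixes \<theta> :: "'a rel \<Rightarrow> 'a rel" and \<theta>' :: "'b rel \<Rightarrow> 'b rel"
  assumes \<theta>: "theta_recursion \<theta>" and \<theta>': "theta_recursion \<theta>'"
    and "WN r" "r \<noteq> {}" "inj_on \<sigma> (Field r)"
  shows "\<theta>' (relabel \<sigma> r) = relabel \<sigma> (\<theta> r)"
proof -
  have "WN r \<and> r \<noteq> {}"
    using assms by simp
  then show ?thesis
    using assms(5)
  proof (induction rule: WN.poset_class_induct)
    case (singleton x)
    then show ?case
      using \<theta> \<theta>' by (simp add: theta_recursion_def relabel_def)
  next
    case (disconnected r)
    have r: "WN r" "finite_poset r"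
      using disconnected(1) by (auto simp: WN_iff)
    have inj: "inj_on \<sigma> (Field c)" if "c \<in> components r" for c
      using component_eq_Restr(2)[OF r(2) that] inj_on_subset[OF disconnected.prems]
      by (auto simp: saturated_def)
    have "\<not> connected_poset (relabel \<sigma> r)"
      using connected_relabel_iff[OF disconnected.prems r(2)] disconnected(2) by simp
    then have "\<theta>' (relabel \<sigma> r) = (\<Union>c\<in>components (relabel \<sigma> r). \<theta>' c)"
      using \<theta>' WN_relabel[OF disconnected.prems r(1)] by (simp add: theta_recursion_def)
    also have "\<dots> = (\<Union>c\<in>components r. \<theta>' (relabel \<sigma> c))"
      by (simp add: components_relabel[OF disconnected.prems r(2)])
    also have "\<dots> = (\<Union>c\<in>components r. relabel \<sigma> (\<theta> c))"
      using disconnected.IH inj by simp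
    also have "\<dots> = relabel \<sigma> (\<Union>c\<in>components r. \<theta> c)"
      by (simp add: relabel_Union image_image)
    also have "(\<Union>c\<in>components r. \<theta> c) = \<theta> r"
      using \<theta> r(1) disconnected(2) by (simp add: theta_recursion_def)
    finally show ?case .
  next
    case (composite r r1 r2)
    have F: "Field r = Field r1 \<union> Field r2"
      using WN.composite[OF composite(1)] by simp
    have inj: "inj_on \<sigma> (Field r1)" "inj_on \<sigma> (Field r2)"
      using composite.prems unfolding F by (auto simp: inj_on_Un)
    have d: "WN r1" "r1 \<noteq> {}" "WN r2" "r2 \<noteq> {}" "Field r1 \<inter> Field r2 = {}" "r = r1 \<down> r2"
        "\<not> connected_poset r2 \<or> card (Field r2) = 1"
      using composite(1) by (auto simp: decomposition_def)
    have "Field (relabel \<sigma> r1) \<inter> Field (relabel \<sigma> r2) = {}"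
      using inj_on_image_Int[OF composite.prems, of "Field r1" "Field r2"] d(5)
      by (simp add: Field_relabel F)
    moreover have "\<not> connected_poset (relabel \<sigma> r2) \<or> card (Field (relabel \<sigma> r2)) = 1"
      using d(3,7) connected_relabel_iff[OF inj(2)] card_image[OF inj(2)]
      by (auto simp: Field_relabel WN_iff)
    moreover have "relabel \<sigma> r1 \<noteq> {}" "relabel \<sigma> r2 \<noteq> {}"
      using d by (simp_all add: relabel_empty_iff)
    ultimately have "decomposition (\<lambda>r. WN r \<and> r \<noteq> {}) (\<down>) (relabel \<sigma> r) (relabel \<sigma> r1) (relabel \<sigma> r2)"
      using WN_relabel[OF inj(1) d(1)] WN_relabel[OF inj(2) d(3)] d(6)
      by (auto simp: decomposition_def relabel_down_prod)
    then have "\<theta>' (relabel \<sigma> r) = \<theta>' (relabel \<sigma> r1) \<triangledown> \<theta>' (relabel \<sigma> r2)"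
      using \<theta>' by (auto simp: theta_recursion_iff recursion_def)
    also have "\<dots> = relabel \<sigma> (\<theta> r1) \<triangledown> relabel \<sigma> (\<theta> r2)"
      using composite.IH inj by simp
    \<comment> \<open>Minimal elements enter \<open>\<triangledown>\<close>, so
      \<open>\<sigma>\<close> must be injective on the field of \<open>\<theta> r2\<close>, which is
      that of \<open>r2\<close>.\<close>
    also have "\<dots> = relabel \<sigma> (\<theta> r1 \<triangledown> \<theta> r2)"
      using relabel_tri_prod[of \<sigma> "\<theta> r2" "\<theta> r1"] inj(2) theta_image(2)[OF \<theta> d(3,4)] by simp
    also have "\<theta> r1 \<triangledown> \<theta> r2 = \<theta> r"
      using \<theta> composite(1) by (auto simp: theta_recursion_iff recursion_def)
    finally show ?case .
  qed
qed

text \<open>Naturality along the identity compares two solutions of the recursion.\<close>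

lemma theta_unique:
  assumes "theta_recursion \<theta>" "theta_recursion \<theta>'" "WN r" "r \<noteq> {}"
  shows "\<theta> r = \<theta>' r"
  using theta_natural[OF assms, of id] by (simp add: relabel_id)

lemma relabel_WN_posets_on:
  assumes "finite A" "A \<noteq> {}" "bij_betw \<sigma> A B" "r \<in> WN_posets_on A"
  shows "relabel \<sigma> r \<in> WN_posets_on B"
proof -
  have "finite B" "B \<noteq> {}" "\<sigma> ` A = B" "inj_on \<sigma> A"
    using assms(1-3) bij_betw_finite by (auto simp: bij_betw_def)
  then show ?thesis
    using assms WN_relabel[of \<sigma> r] by (auto simp: WN_posets_on_iff Field_relabel relabel_empty_iff)
qed

text \<open>By surjectivity \<open>r\<close> is \<open>\<theta> s\<close>; then \<open>s\<close> is
  relabelled as a WN poset, and naturality identifies its image with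
  \<open>relabel \<sigma> r\<close>.\<close>

lemma relabel_tri_compatible_posets_on:
  fixes A :: "'a set" and B :: "'b set"
  assumes "finite A" "A \<noteq> {}" "bij_betw \<sigma> A B" "r \<in> tri_compatible_posets_on A"
  shows "relabel \<sigma> r \<in> tri_compatible_posets_on B"
proof -
  obtain \<theta> :: "'a rel \<Rightarrow> 'a rel" and \<theta>' :: "'b rel \<Rightarrow> 'b rel"
    where \<theta>: "theta_recursion \<theta>" and \<theta>': "theta_recursion \<theta>'"
    using theta_exists by meson
  have B: "finite B" "B \<noteq> {}"
    using assms(1-3) bij_betw_finite by (auto simp: bij_betw_def)
  obtain s where s: "s \<in> WN_posets_on A" "r = \<theta> s"
    using theta_bij_betw[OF \<theta> assms(1,2)] assms(4) by (metis bij_betw_imp_surj_on imageE)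
  then have "relabel \<sigma> r = \<theta>' (relabel \<sigma> s)"
    using theta_natural[OF \<theta> \<theta>', of s \<sigma>] assms(1-3)
    by (auto simp: WN_posets_on_iff bij_betw_def)
  then show ?thesis
    using theta_bij_betw[OF \<theta>' B] relabel_WN_posets_on[OF assms(1-3) s(1)]
    by (metis bij_betw_imp_surj_on imageI)
qed


section \<open>Linear extensions and species\<close>

lemma lookup_fscale: "Poly_Mapping.lookup (fscale c v) p = c * Poly_Mapping.lookup v p"
  by (simp add: fscale_def Poly_Mapping.map.rep_eq when_def)

lemma vector_space_fscale: "vector_space fscale"
  by unfold_locales
    (auto intro!: poly_mapping_eqI simp: lookup_fscale lookup_add algebra_simps)

lemma keys_fscale: "Poly_Mapping.keys (fscale c v) \<subseteq> Poly_Mapping.keys v"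
  by (auto simp: in_keys_iff lookup_fscale)

lemma subspace_free_on: "module.subspace fscale (free_on S)"
proof -
  interpret vector_space fscale
    by (rule vector_space_fscale)
  show ?thesis
    unfolding subspace_def free_on_def using Poly_Mapping.keys_add keys_fscale by fastforce
qed

text \<open>Lets several vectors be expanded over one common index set, since keys may vanish in
  sums and scalar multiples.\<close>

lemma lin_ext_superset:
  assumes "finite S" "Poly_Mapping.keys v \<subseteq> S"
  shows "lin_ext h v = (\<Sum>p\<in>S. Poly_Mapping.single (h p) (Poly_Mapping.lookup v p))"
  unfolding lin_ext_def
  by (rule sum.mono_neutral_left) (use assms in \<open>auto simp: in_keys_iff\<close>)

lemma lin_ext_add: "lin_ext h (v + w) = lin_ext h v + lin_ext h w"
proof -
  let ?S = "Poly_Mapping.keys v \<union> Poly_Mapping.keys w"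
  have "lin_ext h u = (\<Sum>p\<in>?S. Poly_Mapping.single (h p) (Poly_Mapping.lookup u p))"
    if "u \<in> {v, w, v + w}" for u
    by (rule lin_ext_superset) (use that Poly_Mapping.keys_add[of v w] in auto)
  then show ?thesis
    by (simp add: lookup_add single_add sum.distrib)
qed

lemma fscale_single: "fscale c (Poly_Mapping.single p a) = Poly_Mapping.single p (c * a)"
  by (rule poly_mapping_eqI) (simp add: lookup_fscale lookup_single when_def)

lemma lin_ext_fscale: "lin_ext h (fscale c v) = fscale c (lin_ext h v)"
proof -
  interpret vector_space fscale
    by (rule vector_space_fscale)
  have "lin_ext h (fscale c v) =
      (\<Sum>p\<in>Poly_Mapping.keys v. Poly_Mapping.single (h p) (Poly_Mapping.lookup (fscale c v) p))"
    by (rule lin_ext_superset) (auto simp: keys_fscale)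
  then show ?thesis
    by (simp add: lin_ext_def scale_sum_right fscale_single lookup_fscale)
qed

lemma lin_ext_single: "lin_ext h (Poly_Mapping.single p a) = Poly_Mapping.single (h p) a"
  using lin_ext_superset[of "{p}" "Poly_Mapping.single p a" h] by simp

lemma lin_ext_sum: "lin_ext h (\<Sum>i\<in>I. v i) = (\<Sum>i\<in>I. lin_ext h (v i))"
proof (induction I rule: infinite_finite_induct)
  case (insert i I)
  then show ?case
    by (simp add: lin_ext_add)
qed (simp_all add: lin_ext_def)

lemma lin_ext_comp: "lin_ext g (lin_ext h v) = lin_ext (g \<circ> h) v"
  unfolding lin_ext_def[of h] lin_ext_sum lin_ext_single by (simp add: lin_ext_def)

lemma lin_ext_cong:
  "(\<And>p. p \<in> Poly_Mapping.keys v \<Longrightarrow> g p = h p) \<Longrightarrow> lin_ext g v = lin_ext h v"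
  by (simp add: lin_ext_def)

lemma lin_ext_id: "lin_ext id v = v"
proof (rule poly_mapping_eqI)
  fix p
  have "Poly_Mapping.lookup (lin_ext id v) p =
      (\<Sum>q\<in>Poly_Mapping.keys v. Poly_Mapping.lookup v q when q = p)"
    by (simp add: lin_ext_def lookup_sum lookup_single)
  also have "\<dots> = Poly_Mapping.lookup v p"
    by (simp add: when_def in_keys_iff)
  finally show "Poly_Mapping.lookup (lin_ext id v) p = Poly_Mapping.lookup v p" .
qed

lemma keys_lin_ext: "Poly_Mapping.keys (lin_ext h v) \<subseteq> h ` Poly_Mapping.keys v"
proof
  fix q assume "q \<in> Poly_Mapping.keys (lin_ext h v)"
  then have "(\<Sum>p\<in>Poly_Mapping.keys v. Poly_Mapping.lookup v p when h p = q) \<noteq> 0"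
    by (simp add: in_keys_iff lin_ext_def lookup_sum lookup_single)
  then obtain p where "p \<in> Poly_Mapping.keys v" "(Poly_Mapping.lookup v p when h p = q) \<noteq> 0"
    by (rule sum.not_neutral_contains_not_neutral)
  then show "q \<in> h ` Poly_Mapping.keys v"
    by (auto simp: when_def split: if_splits)
qed

lemma lin_ext_free_on: "h ` S \<subseteq> T \<Longrightarrow> lin_ext h ` free_on S \<subseteq> free_on T"
  unfolding free_on_def using keys_lin_ext[of h] by fast

lemma linear_lin_ext:
  "h ` S \<subseteq> T \<Longrightarrow> linear_from_to fscale fscale (free_on S) (free_on T) (lin_ext h)"
  unfolding linear_from_to_def by (simp add: lin_ext_free_on lin_ext_add lin_ext_fscale)

text \<open>By functoriality, \<open>lin_ext\<close> of the inverse of \<open>h\<close> on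
  \<open>S\<close> inverts \<open>lin_ext h\<close> on the free spaces.\<close>

lemma bij_betw_lin_ext:
  assumes "bij_betw h S T"
  shows "bij_betw (lin_ext h) (free_on S) (free_on T)"
proof (rule bij_betw_byWitness[where f' = "lin_ext (inv_into S h)"])
  have inv: "lin_ext (g \<circ> f) v = v" if "\<And>p. p \<in> U \<Longrightarrow> g (f p) = p" "v \<in> free_on U" for f g U v
    using lin_ext_cong[of v "g \<circ> f" id] that by (auto simp: free_on_def lin_ext_id)
  show "\<forall>v\<in>free_on S. lin_ext (inv_into S h) (lin_ext h v) = v"
    using bij_betw_inv_into_left[OF assms] by (auto simp: lin_ext_comp intro: inv)
  show "\<forall>v\<in>free_on T. lin_ext h (lin_ext (inv_into S h) v) = v"
    using bij_betw_inv_into_right[OF assms] by (auto simp: lin_ext_comp intro: inv)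
  show "lin_ext h ` free_on S \<subseteq> free_on T" "lin_ext (inv_into S h) ` free_on T \<subseteq> free_on S"
    using bij_betw_imp_surj_on[OF assms] bij_betw_imp_surj_on[OF bij_betw_inv_into[OF assms]]
    by (simp_all add: lin_ext_free_on)
qed

section \<open>Species of posets and their isomorphism\<close>

lemma linear_species_poset_species:
  fixes P :: "'a set \<Rightarrow> 'a rel set"
  assumes F: "\<And>A r. finite A \<Longrightarrow> A \<noteq> {} \<Longrightarrow> r \<in> P A \<Longrightarrow> Field r = A"
    and relabel: "\<And>A B \<sigma> r. finite A \<Longrightarrow> A \<noteq> {} \<Longrightarrow> bij_betw \<sigma> A B \<Longrightarrow> r \<in> P A \<Longrightarrow> relabel \<sigma> r \<in> P B"
  shows "linear_species (fscale :: 'k::field \<Rightarrow> _) (poset_species P)"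
  unfolding linear_species_def poset_species_def species.simps
proof (intro conjI allI impI ballI)
  fix A B :: "'a set" and \<sigma> assume "finite A \<and> A \<noteq> {} \<and> bij_betw \<sigma> A B"
  then show "linear_from_to (fscale :: 'k \<Rightarrow> _) fscale (free_on (P A)) (free_on (P B)) (lin_ext (relabel \<sigma>))"
    using relabel by (intro linear_lin_ext) auto
next
  fix A :: "'a set" and \<sigma> \<sigma>' and v :: "'a rel \<Rightarrow>\<^sub>0 'k"
  assume A: "finite A \<and> A \<noteq> {} \<and> inj_on \<sigma> A \<and> (\<forall>x\<in>A. \<sigma> x = \<sigma>' x)" and v: "v \<in> free_on (P A)"
  show "lin_ext (relabel \<sigma>) v = lin_ext (relabel \<sigma>') v"
  proof (rule lin_ext_cong)
    \<comment> \<open>Only posets with field exactly \<open>A\<close> occur in \<open>v\<close>, so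
      values of \<open>\<sigma>\<close> outside \<open>A\<close> have no influence.\<close>
    fix r assume "r \<in> Poly_Mapping.keys v"
    then have "Field r = A"
      using F v A by (auto simp: free_on_def)
    then show "relabel \<sigma> r = relabel \<sigma>' r"
      using A by (intro relabel_cong) auto
  qed
next
  fix v :: "'a rel \<Rightarrow>\<^sub>0 'k"
  have "relabel id = (id :: 'a rel \<Rightarrow> 'a rel)"
    by (rule ext) (simp add: relabel_id)
  then show "lin_ext (relabel id) v = v"
    by (simp add: lin_ext_id)
next
  fix \<sigma> \<tau> :: "'a \<Rightarrow> 'a" and v :: "'a rel \<Rightarrow>\<^sub>0 'k"
  have "relabel (\<tau> \<circ> \<sigma>) = relabel \<tau> \<circ> relabel \<sigma>"
    by (rule ext) (simp add: relabel_comp)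
  then show "lin_ext (relabel (\<tau> \<circ> \<sigma>)) v = lin_ext (relabel \<tau>) (lin_ext (relabel \<sigma>) v)"
    by (simp add: lin_ext_comp)
qed (simp_all add: vector_space_fscale subspace_free_on)

lemma theta_species_iso:
  assumes \<theta>: "theta_recursion \<theta>"
  shows "species_iso fscale fscale
    (WNP_species :: ('a, 'a rel \<Rightarrow>\<^sub>0 'k::field) species) CP_tri_species (\<lambda>A. lin_ext \<theta>)"
  unfolding species_iso_def
proof (intro conjI allI impI ballI)
  show "linear_species (fscale :: 'k \<Rightarrow> _) (WNP_species :: ('a, 'a rel \<Rightarrow>\<^sub>0 'k) species)"
    unfolding WNP_species_def
    by (rule linear_species_poset_species) (simp add: WN_posets_on_iff, rule relabel_WN_posets_on)
  show "linear_species (fscale :: 'k \<Rightarrow> _) (CP_tri_species :: ('a, 'a rel \<Rightarrow>\<^sub>0 'k) species)"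
    unfolding CP_tri_species_def
    by (rule linear_species_poset_species)
      (simp add: tri_compatible_posets_on_iff, rule relabel_tri_compatible_posets_on)
next
  fix A :: "'a set" assume A: "finite A \<and> A \<noteq> {}"
  then have bij: "bij_betw \<theta> (WN_posets_on A) (tri_compatible_posets_on A)"
    using theta_bij_betw[OF \<theta>] by blast
  show "linear_from_to (fscale :: 'k \<Rightarrow> _) fscale (obj WNP_species A) (obj CP_tri_species A) (lin_ext \<theta>)"
    unfolding WNP_species_def CP_tri_species_def poset_species_def species.simps
    using bij_betw_imp_surj_on[OF bij] by (intro linear_lin_ext) simp
  show "bij_betw (lin_ext \<theta>) (obj (WNP_species :: ('a, 'a rel \<Rightarrow>\<^sub>0 'k) species) A) (obj CP_tri_species A)"
    unfolding WNP_species_def CP_tri_species_def poset_species_def species.simps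
    by (rule bij_betw_lin_ext[OF bij])
next
  fix A B :: "'a set" and \<sigma> and v :: "'a rel \<Rightarrow>\<^sub>0 'k"
  assume A: "finite A \<and> A \<noteq> {} \<and> bij_betw \<sigma> A B" and "v \<in> obj WNP_species A"
  then have v: "Poly_Mapping.keys v \<subseteq> WN_posets_on A"
    by (simp add: WNP_species_def poset_species_def free_on_def)
  \<comment> \<open>Each side of the naturality square is a single linear extension by
    \<open>lin_ext_comp\<close>, so agreement on basis elements suffices.\<close>
  have "lin_ext (\<theta> \<circ> relabel \<sigma>) v = lin_ext (relabel \<sigma> \<circ> \<theta>) v"
  proof (rule lin_ext_cong)
    fix r assume "r \<in> Poly_Mapping.keys v"
    then have "WN r" "r \<noteq> {}" "Field r = A"
      using v A by (auto simp: WN_posets_on_iff)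
    then show "(\<theta> \<circ> relabel \<sigma>) r = (relabel \<sigma> \<circ> \<theta>) r"
      using theta_natural[OF \<theta> \<theta>, of r \<sigma>] A by (simp add: bij_betw_def)
  qed
  then show "lin_ext \<theta> (act WNP_species A \<sigma> v) = act CP_tri_species A \<sigma> (lin_ext \<theta> v)"
    by (simp add: WNP_species_def CP_tri_species_def poset_species_def lin_ext_comp)
qed

theorem mainTheorem12:
  shows "species_isomorphic fscale fscale
           (WNP_species :: ('a, 'a rel \<Rightarrow>\<^sub>0 'k::field) species)
           (CP_tri_species :: ('a, 'a rel \<Rightarrow>\<^sub>0 'k) species) \<and>
    (\<forall>r :: 'a rel. WN r \<and> connected_poset r \<and> card (Field r) > 1 \<longrightarrow>
       (\<exists>!p. down_decomposition r (fst p) (snd p))) \<and>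
    (\<exists>\<theta> :: 'a rel \<Rightarrow> 'a rel. theta_recursion \<theta>) \<and>
    (\<forall>(\<theta> :: 'a rel \<Rightarrow> 'a rel) \<theta>'. theta_recursion \<theta> \<and> theta_recursion \<theta>' \<longrightarrow>
       (\<forall>r. WN r \<and> r \<noteq> {} \<longrightarrow> \<theta> r = \<theta>' r)) \<and>
    (\<forall>\<theta> :: 'a rel \<Rightarrow> 'a rel. theta_recursion \<theta> \<longrightarrow>
       (\<forall>A. finite A \<and> A \<noteq> {} \<longrightarrow>
          bij_betw \<theta> (WN_posets_on A) (tri_compatible_posets_on A)) \<and>
       (\<forall>(\<theta>' :: 'b rel \<Rightarrow> 'b rel) A B \<sigma>.
          theta_recursion \<theta>' \<and> finite A \<and> A \<noteq> {} \<and> bij_betw \<sigma> A B \<longrightarrow>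
          (\<forall>r\<in>WN_posets_on A. \<theta>' (relabel \<sigma> r) = relabel \<sigma> (\<theta> r))) \<and>
       species_iso fscale fscale
         (WNP_species :: ('a, 'a rel \<Rightarrow>\<^sub>0 'k) species) CP_tri_species
         (\<lambda>A. lin_ext \<theta>))"
proof (intro conjI allI impI ballI)
  show "species_isomorphic fscale fscale
           (WNP_species :: ('a, 'a rel \<Rightarrow>\<^sub>0 'k) species) (CP_tri_species :: ('a, 'a rel \<Rightarrow>\<^sub>0 'k) species)"
    using theta_exists theta_species_iso unfolding species_isomorphic_def by blast
  show "\<exists>!p. down_decomposition r (fst p) (snd p)"
    if r: "WN r \<and> connected_poset r \<and> card (Field r) > 1" for r :: "'a rel"
  proof -
    have "r \<noteq> {}"
      using r by auto
    then obtain r1 r2 where D: "down_decomposition r r1 r2"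
      using WN.decomposition_exists[of r] r unfolding down_decomposition_iff by blast
    show ?thesis
    proof (rule ex1I[of _ "(r1, r2)"])
      fix p assume "down_decomposition r (fst p) (snd p)"
      then show "p = (r1, r2)"
        using WN.decomposition_unique[of r r1 r2 "fst p" "snd p"] D
        unfolding down_decomposition_iff by (simp add: prod_eq_iff)
    qed (use D in simp)
  qed
  show "\<exists>\<theta> :: 'a rel \<Rightarrow> 'a rel. theta_recursion \<theta>"
    by (rule theta_exists)
  show "\<theta> r = \<theta>' r" if "theta_recursion \<theta> \<and> theta_recursion \<theta>'" "WN r \<and> r \<noteq> {}"
    for \<theta> \<theta>' :: "'a rel \<Rightarrow> 'a rel" and r
    using theta_unique that by blast
next
  fix \<theta> :: "'a rel \<Rightarrow> 'a rel" assume \<theta>: "theta_recursion \<theta>"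
  show "bij_betw \<theta> (WN_posets_on A) (tri_compatible_posets_on A)" if "finite A \<and> A \<noteq> {}" for A
    using theta_bij_betw[OF \<theta>] that by blast
  show "species_iso fscale fscale
         (WNP_species :: ('a, 'a rel \<Rightarrow>\<^sub>0 'k) species) CP_tri_species (\<lambda>A. lin_ext \<theta>)"
    by (rule theta_species_iso[OF \<theta>])
  fix \<theta>' :: "'b rel \<Rightarrow> 'b rel" and A :: "'a set" and B :: "'b set" and \<sigma> r
  assume "theta_recursion \<theta>' \<and> finite A \<and> A \<noteq> {} \<and> bij_betw \<sigma> A B" "r \<in> WN_posets_on A"
  then show "\<theta>' (relabel \<sigma> r) = relabel \<sigma> (\<theta> r)"
    using theta_natural[OF \<theta>, of \<theta>' r \<sigma>] by (auto simp: WN_posets_on_iff bij_betw_def)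
qed

end
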